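(* Let $(M,\mathcal T)$ be a closed triangulated surface with inversive distance $I\ge 0$ in hyperbolic background geometry. Then there exists a metric of zero curvature $r^*\in\Omega$ (i.e. $K_i(r^* )=0$ for all $i\in V$) if and only if, for every initial value $r(0)\in\Omega$, the solution $r(t)$ of the flow $r_i'(t)=-K_i\sinh r_i$ $(i=1,\dots,N)$ can be extended to a convergent solution of the extended flow $r_i'(t)=-\widetilde K_i\sinh r_i$ $(i=1,\dots,N)$ on $[0,+\infty)$. Furthermore, if the extended solution converges, then it converges exponentially fast to $r^*$ as $t\to+\infty$.
   Context: Setting. $M$ is a closed surface with a triangulation $\mathcal T=\{V,E,F\}$ (vertices, edges, faces), with vertices numbered $1,\dots,N$. The inversive distance is a fixed function $I:E\to[0,+\infty)$, $\{ij\}\mapsto I_{ij}$. For $r=(r_1,\dots,r_N)\in\mathbb R^N_{>0}$, each edge $\{ij\}$ gets the hyperbolic length $l_{ij}=\cosh^{-1}(\cosh r_i\cosh r_j+I_{ij}\sinh r_i\sinh r_j)$. $\Omega$ is the set of $r\in\mathbb R^N_{>0}$ such that for every face $\{ijk\}\in F$ the lengths $l_{ij},l_{jk},l_{ik}$ satisfy the three strict triangle inequalities. For $r\in\Omega$, $\theta_i^{jk}$ is the inner angle at vertex $i$ of the hyperbolic triangle with edge lengths $l_{ij},l_{jk},l_{ik}$, and the discrete Gaussian curvature is $K_i(r)=2\pi-\sum_{\{ijk\}\in F}\theta_i^{jk}$ (sum over faces containing $i$). Extended curvature. For every $r\in\mathbb R^N_{>0}$ and face $\{ijk\}$, the generalized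 inner angles are: $\tilde\theta_i^{jk}=\theta_i^{jk}$ (and similarly at $j,k$) if $l_{ij},l_{jk},l_{ik}$ satisfy the strict triangle inequalities; if one edge length is at least the sum of the other two, the generalized angle opposite to that edge is $\pi$ and the other two generalized angles are $0$. The extended curvature is $\widetilde K_i(r)=2\pi-\sum_{\{ijk\}\in F}\tilde\theta_i^{jk}$, a continuous function on $\mathbb R^N_{>0}$ that agrees with $K_i$ on $\Omega$. Convention. A solution converges if it exists for all $t\in[0,+\infty)$ and tends, in the Euclidean topology, to some point of $\Omega$ as $t\to+\infty$. Exponentially fast convergence to $r^*$ means $\|r(t)-r^*\|\le Ce^{-ct}$ for all $t\ge0$ with some constants $C,c>0$. *)

theory Defs
  imports "HOL-Analysis.Analysis"
begin

section \<open>Closed triangulated surfaces\<close>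

definition closed_surface :: "'m topology \<Rightarrow> bool" where
  "closed_surface M \<longleftrightarrow>
     topspace M \<noteq> {} \<and> compact_space M \<and> Hausdorff_space M \<and>
     (\<forall>x\<in>topspace M. \<exists>U (W :: (real^2) set).
        openin M U \<and> x \<in> U \<and> open W \<and>
        subtopology M U homeomorphic_space top_of_set W)"

text \<open>The vertex set is the whole index type \<open>'v\<close>, so that the number of vertices is
  \<open>CARD('v)\<close>; edges and faces are identified with their sets of vertices.\<close>

definition simplicial_2_complex :: "'v::finite set set \<Rightarrow> 'v set set \<Rightarrow> bool" where
  "simplicial_2_complex E F \<longleftrightarrow>
     (\<forall>e\<in>E. card e = 2) \<and> (\<forall>f\<in>F. card f = 3) \<and>
     (\<forall>f\<in>F. \<forall>e. e \<subseteq> f \<and> card e = 2 \<longrightarrow> e \<in> E)"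

definition simplices :: "'v::finite set set \<Rightarrow> 'v set set \<Rightarrow> 'v set set" where
  "simplices E F = range (\<lambda>v. {v}) \<union> E \<union> F"

definition geometric_realization :: "'v::finite set set \<Rightarrow> 'v set set \<Rightarrow> (real^'v) set" where
  "geometric_realization E F =
     {x. (\<forall>v. 0 \<le> x $ v) \<and> (\<Sum>v\<in>UNIV. x $ v) = 1 \<and> {v. x $ v \<noteq> 0} \<in> simplices E F}"

definition triangulates :: "'m topology \<Rightarrow> 'v::finite set set \<Rightarrow> 'v set set \<Rightarrow> bool" where
  "triangulates M E F \<longleftrightarrow>
     simplicial_2_complex E F \<and>
     top_of_set (geometric_realization E F) homeomorphic_space M"


section \<open>Hyperbolic triangles\<close>

text \<open>The hyperbolic plane is the upper sheet of the hyperboloid in Minkowski 3-space, the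
  space-like plane being \<open>complex\<close>.\<close>

definition mink :: "complex \<times> real \<Rightarrow> complex \<times> real \<Rightarrow> real" where
  "mink x y = fst x \<bullet> fst y - snd x * snd y"

definition hyp_plane :: "(complex \<times> real) set" where
  "hyp_plane = {x. mink x x = - 1 \<and> 0 < snd x}"

definition hyp_dist :: "complex \<times> real \<Rightarrow> complex \<times> real \<Rightarrow> real" where
  "hyp_dist x y = arcosh (- mink x y)"

text \<open>The initial direction at \<open>A\<close> of the geodesic from \<open>A\<close> to \<open>B\<close> is the Minkowski-orthogonal
  projection of \<open>B\<close> to the tangent plane of the hyperboloid at \<open>A\<close>.\<close>

definition hyp_direction :: "complex \<times> real \<Rightarrow> complex \<times> real \<Rightarrow> complex \<times> real" where
  "hyp_direction A B = B + mink A B *\<^sub>R A"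

definition hyp_angle :: "complex \<times> real \<Rightarrow> complex \<times> real \<Rightarrow> complex \<times> real \<Rightarrow> real" where
  "hyp_angle B A C =
     (let u = hyp_direction A B; v = hyp_direction A C
      in arccos (mink u v / (sqrt (mink u u) * sqrt (mink v v))))"

definition strict_triangle :: "real \<Rightarrow> real \<Rightarrow> real \<Rightarrow> bool" where
  "strict_triangle a b c \<longleftrightarrow> a < b + c \<and> b < a + c \<and> c < a + b"

text \<open>In \<open>inner_angle a b c\<close> and \<open>gen_angle a b c\<close> the angle is the one opposite to the edge of
  length \<open>a\<close>.\<close>

definition inner_angle :: "real \<Rightarrow> real \<Rightarrow> real \<Rightarrow> real" where
  "inner_angle a b c =
     (THE \<theta>. \<exists>A\<in>hyp_plane. \<exists>B\<in>hyp_plane. \<exists>C\<in>hyp_plane.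
        hyp_dist B C = a \<and> hyp_dist A C = b \<and> hyp_dist A B = c \<and> \<theta> = hyp_angle B A C)"

definition gen_angle :: "real \<Rightarrow> real \<Rightarrow> real \<Rightarrow> real" where
  "gen_angle a b c =
     (if strict_triangle a b c then inner_angle a b c
      else if a \<ge> b + c then pi else 0)"

lemma mink_commute: "mink x y = mink y x"
  by (simp add: mink_def inner_commute mult.commute)

lemma mink_add_left: "mink (x + y) z = mink x z + mink y z"
  and mink_add_right: "mink x (y + z) = mink x y + mink x z"
  and mink_scaleR_left: "mink (c *\<^sub>R x) y = c * mink x y"
  and mink_scaleR_right: "mink x (c *\<^sub>R y) = c * mink x y"
  by (simp_all add: mink_def inner_add_left inner_add_right algebra_simps)

lemma mink_le_minus_one:
  assumes "x \<in> hyp_plane" "y \<in> hyp_plane"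
  shows "mink x y \<le> - 1"
proof -
  define s t p q where "s = snd x" "t = snd y" "p = norm (fst x)" "q = norm (fst y)"
  have st: "0 < s" "0 < t" and pq: "0 \<le> p" "0 \<le> q"
    and sp: "s\<^sup>2 = p\<^sup>2 + 1" and tq: "t\<^sup>2 = q\<^sup>2 + 1"
    using assms
    by (auto simp: s_t_p_q_def hyp_plane_def mink_def power2_norm_eq_inner power2_eq_square[of "snd _"])
  have "(p * q + 1)\<^sup>2 \<le> (s * t)\<^sup>2"
  proof -
    have "(s * t)\<^sup>2 = (p\<^sup>2 + 1) * (q\<^sup>2 + 1)"
      by (simp add: power_mult_distrib sp tq)
    also have "\<dots> = (p * q + 1)\<^sup>2 + (p - q)\<^sup>2"
      by (simp add: power2_eq_square algebra_simps)
    finally show ?thesis by simp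
  qed
  then have "p * q + 1 \<le> s * t"
    using st by (intro power2_le_imp_le[of "p * q + 1" "s * t"]) auto
  moreover have "fst x \<bullet> fst y \<le> p * q"
    unfolding s_t_p_q_def by (rule norm_cauchy_schwarz)
  ultimately show ?thesis
    by (simp add: mink_def s_t_p_q_def)
qed

lemma cosh_hyp_dist:
  assumes "x \<in> hyp_plane" "y \<in> hyp_plane"
  shows "cosh (hyp_dist x y) = - mink x y"
  using mink_le_minus_one[OF assms] by (simp add: hyp_dist_def)

lemma hyp_dist_nonneg:
  assumes "x \<in> hyp_plane" "y \<in> hyp_plane"
  shows "0 \<le> hyp_dist x y"
  using mink_le_minus_one[OF assms] by (simp add: hyp_dist_def)

lemma mink_hyp_direction:
  assumes "A \<in> hyp_plane"
  shows "mink (hyp_direction A B) (hyp_direction A C) = mink B C + mink A B * mink A C"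
proof -
  have "mink A A = - 1"
    using assms by (simp add: hyp_plane_def)
  then show ?thesis
    by (simp add: hyp_direction_def mink_add_left mink_add_right mink_scaleR_left
        mink_scaleR_right mink_commute[of B A] algebra_simps)
qed

lemma hyp_angle_cosine_law:
  assumes "A \<in> hyp_plane" "B \<in> hyp_plane" "C \<in> hyp_plane"
    and a: "hyp_dist B C = a" and b: "hyp_dist A C = b" and c: "hyp_dist A B = c"
  shows "hyp_angle B A C = arccos ((cosh b * cosh c - cosh a) / (sinh b * sinh c))"
proof -
  have nonneg: "0 \<le> b" "0 \<le> c"
    using assms hyp_dist_nonneg by blast+
  have m: "mink B C = - cosh a" "mink A C = - cosh b" "mink A B = - cosh c"
    using cosh_hyp_dist[OF assms(2,3)] cosh_hyp_dist[OF assms(1,3)] cosh_hyp_dist[OF assms(1,2)] a b c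
    by simp_all
  have self: "mink B B = - 1" "mink C C = - 1"
    using assms by (auto simp: hyp_plane_def)
  have s: "sqrt (cosh x * cosh x - 1) = sinh x" if "0 \<le> x" for x :: real
  proof -
    have "cosh x * cosh x - 1 = (sinh x)\<^sup>2"
      using cosh_square_eq[of x] by (simp add: power2_eq_square)
    then show ?thesis using that by simp
  qed
  show ?thesis
    by (simp add: hyp_angle_def mink_hyp_direction[OF assms(1)] m self s nonneg mult.commute)
qed

lemma hyp_triangle_exists:
  assumes "strict_triangle a b c"
  shows "\<exists>A\<in>hyp_plane. \<exists>B\<in>hyp_plane. \<exists>C\<in>hyp_plane.
           hyp_dist B C = a \<and> hyp_dist A C = b \<and> hyp_dist A B = c"
proof -
  have pos: "0 < a" "0 < b" "0 < c"
    using assms by (auto simp: strict_triangle_def)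
  define k where "k = (cosh b * cosh c - cosh a) / (sinh b * sinh c)"
  have sbc: "0 < sinh b * sinh c"
    using pos by simp
  have "cosh a \<le> cosh (b + c)"
    using assms pos by (subst cosh_real_nonneg_le_iff) (auto simp: strict_triangle_def)
  then have k1: "- 1 \<le> k"
    using sbc by (simp add: k_def cosh_add field_simps)
  have "cosh \<bar>b - c\<bar> \<le> cosh a"
    using assms pos by (subst cosh_real_nonneg_le_iff) (auto simp: strict_triangle_def)
  then have k2: "k \<le> 1"
    using sbc by (simp add: k_def cosh_diff field_simps)
  define \<theta> where "\<theta> = arccos k"
  have cos\<theta>: "cos \<theta> = k"
    using k1 k2 by (simp add: \<theta>_def)
  define A B C :: "complex \<times> real"
    where "A = (0, 1)" "B = (of_real (sinh c), cosh c)"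
      "C = (of_real (sinh b) * cis \<theta>, cosh b)"
  note ABC = A_B_C_def
  have sq: "cosh x * cosh x = 1 + sinh x * sinh x" for x :: real
    using cosh_square_eq[of x] by (simp add: power2_eq_square)
  have unit: "cos \<theta> * cos \<theta> + sin \<theta> * sin \<theta> = 1"
    using sin_cos_squared_add[of \<theta>] by (simp add: power2_eq_square)
  have "cos \<theta> * (cos \<theta> * (sinh b * sinh b)) + sin \<theta> * (sin \<theta> * (sinh b * sinh b))
      = (cos \<theta> * cos \<theta> + sin \<theta> * sin \<theta>) * (sinh b * sinh b)"
    by (simp only: distrib_right mult.assoc)
  then have CC: "cos \<theta> * (cos \<theta> * (sinh b * sinh b)) + sin \<theta> * (sin \<theta> * (sinh b * sinh b))
      = sinh b * sinh b"
    by (simp only: unit mult_1_left)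
  have H: "A \<in> hyp_plane" "B \<in> hyp_plane" "C \<in> hyp_plane"
    by (auto simp: hyp_plane_def mink_def ABC inner_complex_def sq mult_ac) (use CC in linarith)
  have "mink B C = - cosh a"
    using pos by (simp add: mink_def ABC inner_complex_def cos\<theta> k_def)
  then have "hyp_dist B C = a"
    using pos by (simp add: hyp_dist_def arcosh_cosh_real)
  moreover have "hyp_dist A C = b" "hyp_dist A B = c"
    using pos by (simp_all add: hyp_dist_def mink_def ABC arcosh_cosh_real)
  ultimately show ?thesis
    using H by blast
qed

lemma inner_angle_eq:
  assumes "strict_triangle a b c"
  shows "inner_angle a b c = arccos ((cosh b * cosh c - cosh a) / (sinh b * sinh c))"
  unfolding inner_angle_def
proof (rule the_equality)
  show "\<exists>A\<in>hyp_plane. \<exists>B\<in>hyp_plane. \<exists>C\<in>hyp_plane.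
        hyp_dist B C = a \<and> hyp_dist A C = b \<and> hyp_dist A B = c \<and>
        arccos ((cosh b * cosh c - cosh a) / (sinh b * sinh c)) = hyp_angle B A C"
    using hyp_triangle_exists[OF assms] hyp_angle_cosine_law by metis
qed (use hyp_angle_cosine_law in blast)

lemma gen_angle_commute: "gen_angle a b c = gen_angle a c b"
proof (cases "strict_triangle a b c")
  case True
  then have "strict_triangle a c b"
    by (auto simp: strict_triangle_def)
  with True show ?thesis
    by (simp add: gen_angle_def inner_angle_eq mult.commute)
next
  case False
  then have "\<not> strict_triangle a c b"
    by (auto simp: strict_triangle_def)
  with False show ?thesis
    by (simp add: gen_angle_def add.commute)
qed


section \<open>Inversive distance circle packings and their curvature\<close>

definition edge_length :: "('v set \<Rightarrow> real) \<Rightarrow> real^'v \<Rightarrow> 'v \<Rightarrow> 'v::finite \<Rightarrow> real" where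
  "edge_length I r i j =
     arcosh (cosh (r $ i) * cosh (r $ j) + I {i, j} * sinh (r $ i) * sinh (r $ j))"

definition pos_orthant :: "(real^'v::finite) set" where
  "pos_orthant = {r. \<forall>i. 0 < r $ i}"

definition Omega :: "'v::finite set set \<Rightarrow> ('v set \<Rightarrow> real) \<Rightarrow> (real^'v) set" where
  "Omega F I =
     {r \<in> pos_orthant. \<forall>i j k. {i, j, k} \<in> F \<longrightarrow>
        strict_triangle (edge_length I r i j) (edge_length I r j k) (edge_length I r i k)}"

text \<open>The angle at the vertex \<open>i\<close> of a face \<open>f\<close> with vertices \<open>i, j, k\<close>, where \<open>ang\<close> is one of
  \<open>inner_angle\<close> and \<open>gen_angle\<close>; the value does not depend on the order of the other two
  vertices.\<close>

definition face_angle ::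
  "(real \<Rightarrow> real \<Rightarrow> real \<Rightarrow> real) \<Rightarrow> ('v set \<Rightarrow> real) \<Rightarrow> real^'v \<Rightarrow> 'v::finite \<Rightarrow> 'v set \<Rightarrow> real" where
  "face_angle ang I r i f =
     (THE \<theta>. \<exists>j k. f = {i, j, k} \<and>
        \<theta> = ang (edge_length I r j k) (edge_length I r i k) (edge_length I r i j))"

definition curvature :: "'v::finite set set \<Rightarrow> ('v set \<Rightarrow> real) \<Rightarrow> real^'v \<Rightarrow> 'v \<Rightarrow> real" where
  "curvature F I r i = 2 * pi - (\<Sum>f\<in>{f\<in>F. i \<in> f}. face_angle inner_angle I r i f)"

definition ext_curvature :: "'v::finite set set \<Rightarrow> ('v set \<Rightarrow> real) \<Rightarrow> real^'v \<Rightarrow> 'v \<Rightarrow> real" where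
  "ext_curvature F I r i = 2 * pi - (\<Sum>f\<in>{f\<in>F. i \<in> f}. face_angle gen_angle I r i f)"

lemma edge_length_commute: "edge_length I r i j = edge_length I r j i"
  by (simp add: edge_length_def insert_commute mult_ac)

lemma face_angle_gen_angle:
  assumes "card {i, j, k} = 3"
  shows "face_angle gen_angle I r i {i, j, k}
       = gen_angle (edge_length I r j k) (edge_length I r i k) (edge_length I r i j)"
  unfolding face_angle_def
proof (rule the_equality)
  fix \<theta>
  assume "\<exists>j' k'. {i, j, k} = {i, j', k'} \<and>
    \<theta> = gen_angle (edge_length I r j' k') (edge_length I r i k') (edge_length I r i j')"
  then obtain j' k' where jk: "{i, j, k} = {i, j', k'}"
    and \<theta>: "\<theta> = gen_angle (edge_length I r j' k') (edge_length I r i k') (edge_length I r i j')"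
    by blast
  have "card {i, j', k'} = 3"
    using assms jk by simp
  then have "i \<noteq> j'" "i \<noteq> k'" "j' \<noteq> k'"
    by (auto simp: card_insert_if split: if_splits)
  moreover have "i \<noteq> j" "i \<noteq> k" "j \<noteq> k"
    using assms by (auto simp: card_insert_if split: if_splits)
  ultimately have "(j' = j \<and> k' = k) \<or> (j' = k \<and> k' = j)"
    using jk by (auto simp: set_eq_iff)
  then show "\<theta> = gen_angle (edge_length I r j k) (edge_length I r i k) (edge_length I r i j)"
    using \<theta> by (metis gen_angle_commute edge_length_commute)
qed blast

lemma face_angle_inner_angle:
  assumes "r \<in> Omega F I" "{i, j, k} \<in> F" "card {i, j, k} = 3"
  shows "face_angle inner_angle I r i {i, j, k}
       = inner_angle (edge_length I r j k) (edge_length I r i k) (edge_length I r i j)"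
proof -
  have tri: "strict_triangle (edge_length I r j' k') (edge_length I r i k') (edge_length I r i j')"
    if "{i, j, k} = {i, j', k'}" for j' k'
    using assms that unfolding Omega_def strict_triangle_def by force
  have gen: "gen_angle (edge_length I r j' k') (edge_length I r i k') (edge_length I r i j')
      = inner_angle (edge_length I r j' k') (edge_length I r i k') (edge_length I r i j')"
    if "{i, j, k} = {i, j', k'}" for j' k'
    using tri[OF that] by (simp add: gen_angle_def)
  have "face_angle inner_angle I r i {i, j, k} = face_angle gen_angle I r i {i, j, k}"
    unfolding face_angle_def using gen by (metis (no_types, lifting))
  then show ?thesis
    using tri[OF refl] by (simp add: face_angle_gen_angle[OF assms(3)] gen_angle_def)
qed

definition zero_curvature_metric ::
  "'v::finite set set \<Rightarrow> ('v set \<Rightarrow> real) \<Rightarrow> real^'v \<Rightarrow> bool" where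
  "zero_curvature_metric F I r \<longleftrightarrow> r \<in> Omega F I \<and> (\<forall>i. curvature F I r i = 0)"


section \<open>The flow and the extended flow\<close>

text \<open>At the end points of \<open>J\<close> the derivative is one-sided.\<close>

definition flow_solution ::
  "'v::finite set set \<Rightarrow> ('v set \<Rightarrow> real) \<Rightarrow> real set \<Rightarrow> (real \<Rightarrow> real^'v) \<Rightarrow> bool" where
  "flow_solution F I J r \<longleftrightarrow>
     (\<forall>t\<in>J. r t \<in> Omega F I \<and>
        (r has_vector_derivative (\<chi> i. - curvature F I (r t) i * sinh (r t $ i))) (at t within J))"

definition ext_flow_solution ::
  "'v::finite set set \<Rightarrow> ('v set \<Rightarrow> real) \<Rightarrow> real set \<Rightarrow> (real \<Rightarrow> real^'v) \<Rightarrow> bool" where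
  "ext_flow_solution F I J r \<longleftrightarrow>
     (\<forall>t\<in>J. r t \<in> pos_orthant \<and>
        (r has_vector_derivative (\<chi> i. - ext_curvature F I (r t) i * sinh (r t $ i))) (at t within J))"

definition convergent_ext_solution ::
  "'v::finite set set \<Rightarrow> ('v set \<Rightarrow> real) \<Rightarrow> (real \<Rightarrow> real^'v) \<Rightarrow> bool" where
  "convergent_ext_solution F I r \<longleftrightarrow>
     ext_flow_solution F I {0..} r \<and> (\<exists>p\<in>Omega F I. (r \<longlongrightarrow> p) at_top)"

text \<open>\<open>R\<close> extends the solution of the flow with initial value \<open>r0\<close>: it starts at \<open>r0\<close> and agrees
  with the solution as long as the latter exists. A solution on an unbounded interval is covered
  by its restrictions to the intervals \<open>{0..<T}\<close>.\<close>

definition extends_flow_from ::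
  "'v::finite set set \<Rightarrow> ('v set \<Rightarrow> real) \<Rightarrow> real^'v \<Rightarrow> (real \<Rightarrow> real^'v) \<Rightarrow> bool" where
  "extends_flow_from F I r0 R \<longleftrightarrow>
     R 0 = r0 \<and>
     (\<forall>T>0. \<forall>r. flow_solution F I {0..<T} r \<and> r 0 = r0 \<longrightarrow> (\<forall>t\<in>{0..<T}. R t = r t))"

definition converges_exponentially :: "(real \<Rightarrow> real^'v::finite) \<Rightarrow> real^'v \<Rightarrow> bool" where
  "converges_exponentially r p \<longleftrightarrow>
     (\<exists>C>0. \<exists>c>0. \<forall>t\<ge>0. norm (r t - p) \<le> C * exp (- c * t))"

end

theory Submission
  imports Defs
begin

text \<open>
  Three ideas prove the theorem.

  First, a change of variables. With the dual radii \<open>v\<^sub>i = - ln (tanh (r\<^sub>i / 2))\<close>, characterized by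
  \<open>sinh v\<^sub>i * sinh r\<^sub>i = 1\<close>, the extended flow becomes the autonomous equation \<open>v' = K v\<close>, where \<open>K\<close>
  is the extended curvature expressed in \<open>v\<close> (\<open>dual_field\<close>).

  Second, \<open>K\<close> is dissipative, \<open>(v - w) \<bullet> (K v - K w) \<le> 0\<close> on the whole positive orthant, because in
  each face the generalized angles form a monotone map of the dual radii (\<open>angle_monotone\<close>). Where
  the triangle inequalities hold strictly, the Jacobian of the angles is positive definite. Up to a
  positive factor, its off-diagonal entries are \<open>- b\<^sub>k\<close>, where \<open>b\<^sub>k\<close> is a positive multiple of the
  \<open>k\<close>-th barycentric coordinate of the radical centre of the three circles, and the whole form is
  \<open>\<Sum>k. b\<^sub>k * (cosh l\<^sub>k * (x\<^sub>i\<^sup>2 + x\<^sub>j\<^sup>2) - 2 * x\<^sub>i * x\<^sub>j)\<close>. For non-negative inversive distances at most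
  one \<open>b\<^sub>k\<close> is not positive, and the two positive ones outweigh it by an explicit completion of
  squares (\<open>dual_angle_form_pos\<close>). Where the triangle inequalities fail, the angles are \<open>0\<close> or \<open>pi\<close>,
  so along a segment the pairing of the angles with the direction is a continuous function with
  non-negative derivative wherever it avoids a finite set of values. Such a function is monotone
  (\<open>nondecreasing_off_finite_values\<close>).

  Third, dissipativity governs the flow. Two solutions never move apart, so solutions are unique,
  and the Euler polygons for finer and finer steps form a Cauchy sequence, so solutions exist
  although \<open>K\<close> is merely continuous (\<open>dissipative_flow_exists\<close>). The polygons stay in the orthant
  because the angle at a vertex of large radius is small (\<open>angle_le_of_large_radius\<close>): the curvature
  there is positive and drives the radius down. If \<open>K w = 0\<close> at an admissible \<open>w\<close>, then definiteness of
  the Jacobian at \<open>w\<close>, spread along rays from \<open>w\<close> by monotonicity, gives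
  \<open>(v - w) \<bullet> K v \<le> - c * (norm (v - w))\<^sup>2\<close> on bounded sets (\<open>dual_field_coercive\<close>), and hence
  exponential convergence of every solution to \<open>w\<close>.

  Conversely, the limit in \<open>Omega\<close> of a convergent solution is an equilibrium, so its curvature
  vanishes. To obtain a zero curvature metric from the statement about all initial values one needs
  some initial value, and a large constant radius belongs to \<open>Omega\<close>.
\<close>

section \<open>Dual radii\<close>

text \<open>A primitive of \<open>- 1 / sinh\<close>, which therefore removes the factor \<open>sinh r\<^sub>i\<close> from the flow. It is an
  involution of the positive reals.\<close>

definition dual_radius :: "real \<Rightarrow> real" where
  "dual_radius x = - ln (tanh (x / 2))"

lemma exp_dual_radius:
  assumes "0 < x"
  shows "exp (dual_radius x) = cosh (x / 2) / sinh (x / 2)"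
  using assms by (simp add: dual_radius_def exp_minus tanh_def inverse_eq_divide)

lemma sinh_dual_radius:
  assumes "0 < x"
  shows "sinh (dual_radius x) = 1 / sinh x"
proof -
  define c s where "c = cosh (x / 2)" "s = sinh (x / 2)"
  have pos: "0 < c" "0 < s" using assms by (simp_all add: c_s_def)
  have "c\<^sup>2 = s\<^sup>2 + 1" using cosh_square_eq[of "x / 2"] by (simp add: c_s_def)
  then have e: "c * c - s * s = 1" by (simp add: power2_eq_square)
  have x: "sinh x = 2 * s * c" using sinh_double[of "x / 2"] by (simp add: c_s_def)
  have "sinh (dual_radius x) = (c / s - s / c) / 2"
    unfolding sinh_field_def exp_minus exp_dual_radius[OF assms] c_s_def by simp
  also have "\<dots> = 1 / (2 * s * c)"
    using pos e by (simp add: divide_simps algebra_simps)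
  finally show ?thesis by (simp add: x)
qed

lemma dual_radius_pos:
  assumes "0 < x"
  shows "0 < dual_radius x"
proof -
  have "0 < sinh (dual_radius x)" using assms by (simp add: sinh_dual_radius)
  then show ?thesis by simp
qed

lemma dual_radius_dual_radius:
  assumes "0 < x"
  shows "dual_radius (dual_radius x) = x"
proof -
  have "sinh (dual_radius (dual_radius x)) = sinh x"
    using assms by (simp add: sinh_dual_radius dual_radius_pos)
  then show ?thesis by simp
qed

lemma has_real_derivative_dual_radius:
  assumes "0 < x"
  shows "(dual_radius has_real_derivative - 1 / sinh x) (at x)"
proof -
  define c s where "c = cosh (x / 2)" "s = sinh (x / 2)"
  have pos: "0 < c" "0 < s" using assms by (simp_all add: c_s_def)
  have "c\<^sup>2 = s\<^sup>2 + 1" using cosh_square_eq[of "x / 2"] by (simp add: c_s_def)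
  then have e: "c * c - s * s = 1" by (simp add: power2_eq_square)
  have x: "sinh x = 2 * s * c" using sinh_double[of "x / 2"] by (simp add: c_s_def)
  have "(dual_radius has_real_derivative - ((1 - (s / c)\<^sup>2) * (1 / 2) / (s / c))) (at x)"
    unfolding dual_radius_def[abs_def] c_s_def tanh_def[symmetric]
    using assms by (auto intro!: derivative_eq_intros)
  moreover have "- ((1 - (s / c)\<^sup>2) * (1 / 2) / (s / c)) = - ((c * c - s * s) / (2 * s * c))"
    using pos by (simp add: divide_simps power2_eq_square algebra_simps)
  ultimately show ?thesis by (simp add: x e)
qed

definition dual :: "real^'v::finite \<Rightarrow> real^'v" where
  "dual v = (\<chi> i. dual_radius (v $ i))"

lemma dual_in_pos_orthant: "v \<in> pos_orthant \<Longrightarrow> dual v \<in> pos_orthant"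
  by (simp add: pos_orthant_def dual_def dual_radius_pos)

lemma dual_dual: "v \<in> pos_orthant \<Longrightarrow> dual (dual v) = v"
  by (simp add: pos_orthant_def dual_def dual_radius_dual_radius vec_eq_iff)

lemma open_pos_orthant: "open (pos_orthant :: (real^'v::finite) set)"
proof -
  have "pos_orthant = (\<Inter>i\<in>UNIV. {r :: real^'v. 0 < r $ i})"
    by (auto simp: pos_orthant_def)
  also have "open \<dots>"
    by (intro open_INT) (auto intro!: open_Collect_less continuous_intros)
  finally show ?thesis .
qed

lemma convex_pos_orthant: "convex (pos_orthant :: (real^'v::finite) set)"
proof -
  have "pos_orthant = (\<Inter>i\<in>UNIV. {r :: real^'v. axis i 1 \<bullet> r > 0})"
    by (auto simp: pos_orthant_def inner_axis')
  also have "convex \<dots>"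
    by (intro convex_INT convex_halfspace_gt)
  finally show ?thesis .
qed

lemma has_derivative_dual_component:
  assumes "v \<in> pos_orthant"
  shows "((\<lambda>v. dual v $ i) has_derivative (\<lambda>h. - sinh (dual v $ i) * h $ i)) (at v)"
proof -
  have pos: "0 < v $ i" using assms by (simp add: pos_orthant_def)
  have "((\<lambda>v. dual_radius (v $ i)) has_derivative (\<lambda>h. h $ i * (- 1 / sinh (v $ i)))) (at v)"
    by (rule DERIV_compose_FDERIV[where f = dual_radius])
      (use pos has_real_derivative_dual_radius
        in \<open>auto intro!: bounded_linear_imp_has_derivative bounded_linear_vec_nth\<close>)
  then show ?thesis
    using pos by (simp add: dual_def sinh_dual_radius mult.commute)
qed

lemma has_derivative_vecI:
  fixes f :: "'a::real_normed_vector \<Rightarrow> real^'n"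
  assumes "\<And>i. ((\<lambda>x. f x $ i) has_derivative (\<lambda>h. f' h $ i)) (at a within S)"
  shows "(f has_derivative f') (at a within S)"
proof (subst has_derivative_componentwise_within, rule)
  fix b :: "real^'n" assume "b \<in> Basis"
  then obtain i where "b = axis i 1" by (auto simp: Basis_vec_def)
  then show "((\<lambda>x. f x \<bullet> b) has_derivative (\<lambda>x. f' x \<bullet> b)) (at a within S)"
    using assms[of i] by (simp add: inner_axis)
qed

lemma has_derivative_dual:
  assumes "v \<in> pos_orthant"
  shows "(dual has_derivative (\<lambda>h. \<chi> i. - sinh (dual v $ i) * h $ i)) (at v)"
  by (rule has_derivative_vecI) (use has_derivative_dual_component[OF assms] in simp)

lemma continuous_on_dual: "continuous_on pos_orthant dual"
  by (intro continuous_at_imp_continuous_on ballI has_derivative_continuous[OF has_derivative_dual])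

section \<open>Generalized angles in terms of hyperbolic cosines\<close>

text \<open>The determinant of the matrix of hyperbolic cosines of the mutual distances of three points. It is
  positive if and only if the three positive lengths satisfy the strict triangle inequalities.\<close>

definition triangle_det :: "real \<Rightarrow> real \<Rightarrow> real \<Rightarrow> real" where
  "triangle_det C1 C2 C3 = 1 + 2 * C1 * C2 * C3 - C1\<^sup>2 - C2\<^sup>2 - C3\<^sup>2"

text \<open>The hyperbolic law of cosines. Truncating the cosine to \<open>[-1, 1]\<close> produces exactly the values
  \<open>0\<close> and \<open>pi\<close> of the generalized angles, and makes their continuity evident.\<close>

definition cosine_angle :: "real \<Rightarrow> real \<Rightarrow> real \<Rightarrow> real" where
  "cosine_angle C1 C2 C3 =
     arccos (max (- 1) (min 1 ((C2 * C3 - C1) / (sqrt (C2\<^sup>2 - 1) * sqrt (C3\<^sup>2 - 1)))))"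

lemma sqrt_cosh_square_minus_1: "0 \<le> x \<Longrightarrow> sqrt ((cosh x)\<^sup>2 - 1) = sinh (x::real)"
  by (simp add: cosh_square_eq)

text \<open>By the addition theorem for \<open>cosh\<close>, the untruncated cosine passes \<open>- 1\<close> and \<open>1\<close> exactly where a
  triangle inequality turns into an equality.\<close>

lemma gen_angle_eq_cosine_angle:
  assumes pos: "0 < a" "0 < b" "0 < c"
  shows "gen_angle a b c = cosine_angle (cosh a) (cosh b) (cosh c)"
proof -
  define q where "q = (cosh b * cosh c - cosh a) / (sinh b * sinh c)"
  have sbc: "0 < sinh b * sinh c" using pos by simp
  have q1: "q \<le> - 1 \<longleftrightarrow> b + c \<le> a"
  proof -
    have "q \<le> - 1 \<longleftrightarrow> cosh (b + c) \<le> cosh a"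
      using sbc by (simp add: q_def pos_divide_le_eq cosh_add) linarith
    also have "\<dots> \<longleftrightarrow> b + c \<le> a"
      using pos by (subst cosh_real_nonneg_le_iff) auto
    finally show ?thesis .
  qed
  have q2: "1 \<le> q \<longleftrightarrow> a \<le> \<bar>b - c\<bar>"
  proof -
    have "1 \<le> q \<longleftrightarrow> cosh a \<le> cosh (b - c)"
      using sbc by (simp add: q_def pos_le_divide_eq cosh_diff) linarith
    also have "cosh (b - c) = cosh \<bar>b - c\<bar>" by simp
    also have "cosh a \<le> cosh \<bar>b - c\<bar> \<longleftrightarrow> a \<le> \<bar>b - c\<bar>"
      using pos by (subst cosh_real_nonneg_le_iff) auto
    finally show ?thesis .
  qed
  have "cosine_angle (cosh a) (cosh b) (cosh c) = arccos (max (- 1) (min 1 q))"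
    using pos by (simp only: cosine_angle_def sqrt_cosh_square_minus_1 less_imp_le q_def)
  moreover have "gen_angle a b c = arccos (max (- 1) (min 1 q))"
  proof (cases "strict_triangle a b c")
    case True
    then have "\<not> b + c \<le> a" "\<not> a \<le> \<bar>b - c\<bar>" by (auto simp: strict_triangle_def)
    then have "max (- 1) (min 1 q) = q" using q1 q2 by auto
    with True show ?thesis by (simp add: gen_angle_def inner_angle_eq q_def)
  next
    case False
    then consider "b + c \<le> a" | "\<not> b + c \<le> a" "a \<le> \<bar>b - c\<bar>"
      by (fastforce simp: strict_triangle_def)
    then show ?thesis
    proof cases
      case 1
      then have "max (- 1) (min 1 q) = - 1" using q1 by auto
      with False 1 show ?thesis by (simp add: gen_angle_def)
    next
      case 2
      then have "max (- 1) (min 1 q) = 1" using q2 by auto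
      with False 2 show ?thesis by (simp add: gen_angle_def)
    qed
  qed
  ultimately show ?thesis by simp
qed

lemma triangle_det_eq:
  "triangle_det C1 C2 C3 = (C2\<^sup>2 - 1) * (C3\<^sup>2 - 1) - (C2 * C3 - C1)\<^sup>2"
  by (simp add: triangle_det_def power2_eq_square algebra_simps)

text \<open>The determinant factors as \<open>(cosh (b + c) - cosh a) * (cosh a - cosh (b - c))\<close>.\<close>

lemma strict_triangle_imp_triangle_det_pos:
  assumes "strict_triangle a b c"
  shows "0 < triangle_det (cosh a) (cosh b) (cosh c)"
proof -
  have pos: "0 < a" "0 < b" "0 < c" using assms by (auto simp: strict_triangle_def)
  have "cosh \<bar>b - c\<bar> < cosh a" "cosh a < cosh (b + c)"
    using assms pos by (auto simp: strict_triangle_def cosh_real_nonneg_less_iff simp del: cosh_real_abs)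
  then have "0 < (cosh (b + c) - cosh a) * (cosh a - cosh (b - c))" by simp
  also have "\<dots> = (sinh b)\<^sup>2 * (sinh c)\<^sup>2 - (cosh b * cosh c - cosh a)\<^sup>2"
    by (simp add: cosh_add cosh_diff power2_eq_square algebra_simps)
  finally show ?thesis
    by (simp add: triangle_det_eq cosh_square_eq)
qed

lemma cosine_angle_bounds: "0 \<le> cosine_angle C1 C2 C3" "cosine_angle C1 C2 C3 \<le> pi"
  unfolding cosine_angle_def by (auto intro!: arccos_lbound arccos_ubound)

lemma cosine_angle_degenerate:
  assumes C: "1 < C2" "1 < C3" and det: "triangle_det C1 C2 C3 \<le> 0"
  shows "cosine_angle C1 C2 C3 \<in> {0, pi}"
proof -
  define S where "S = sqrt (C2\<^sup>2 - 1) * sqrt (C3\<^sup>2 - 1)"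
  have S2: "0 < C2\<^sup>2 - 1" "0 < C3\<^sup>2 - 1" using C by (simp_all add: power2_gt_1_iff)
  then have S: "0 < S" by (simp add: S_def)
  have "S\<^sup>2 \<le> (C2 * C3 - C1)\<^sup>2"
    using det S2 by (simp add: triangle_det_eq S_def power_mult_distrib)
  then have "S \<le> \<bar>C2 * C3 - C1\<bar>"
    using S by (metis abs_le_square_iff abs_of_pos)
  then have "(C2 * C3 - C1) / S \<le> - 1 \<or> 1 \<le> (C2 * C3 - C1) / S"
    using S by (auto simp: pos_divide_le_eq pos_le_divide_eq)
  then have "max (- 1) (min 1 ((C2 * C3 - C1) / S)) \<in> {- 1, 1}" by auto
  then show ?thesis unfolding cosine_angle_def S_def[symmetric] by auto
qed

lemma continuous_on_cosine_angle:
  fixes f1 f2 f3 :: "'a::topological_space \<Rightarrow> real"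
  assumes "continuous_on S f1" "continuous_on S f2" "continuous_on S f3"
    and "\<And>x. x \<in> S \<Longrightarrow> 1 < f2 x" "\<And>x. x \<in> S \<Longrightarrow> 1 < f3 x"
  shows "continuous_on S (\<lambda>x. cosine_angle (f1 x) (f2 x) (f3 x))"
proof -
  have "(f2 x)\<^sup>2 - 1 \<noteq> 0" "(f3 x)\<^sup>2 - 1 \<noteq> 0" if "x \<in> S" for x
    using assms(4,5)[OF that] by (auto simp: power2_eq_1_iff)
  then show ?thesis
    unfolding cosine_angle_def using assms(1-3) by (intro continuous_intros) auto
qed

lemma has_real_derivative_arccos_clamp:
  assumes "- 1 < y" "y < 1"
  shows "((\<lambda>y. arccos (max (- 1) (min 1 y))) has_real_derivative - 1 / sqrt (1 - y\<^sup>2)) (at y)"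
proof -
  have "(arccos has_real_derivative - 1 / sqrt (1 - y\<^sup>2)) (at y)"
    using DERIV_arccos[OF assms] by (simp add: divide_inverse)
  then show ?thesis
    by (rule has_field_derivative_transform_within_open[of _ _ _ "{-1<..<1}"]) (use assms in auto)
qed

text \<open>Inside the range of the strict triangle inequalities the truncation is locally inactive; since
  \<open>sqrt (1 - y\<^sup>2) = sqrt (triangle_det C1 C2 C3) / (sqrt (C2\<^sup>2 - 1) * sqrt (C3\<^sup>2 - 1))\<close>
  for the cosine \<open>y\<close>, the derivative is rational up to the factor \<open>1 / sqrt (triangle_det C1 C2 C3)\<close>.\<close>

lemma has_derivative_cosine_angle:
  fixes f1 f2 f3 :: "'a::real_normed_vector \<Rightarrow> real"
  assumes d: "(f1 has_derivative d1) (at x)" "(f2 has_derivative d2) (at x)" "(f3 has_derivative d3) (at x)"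
    and C: "f1 x = C1" "f2 x = C2" "f3 x = C3" "1 < C2" "1 < C3"
    and det: "0 < triangle_det C1 C2 C3"
  shows "((\<lambda>x. cosine_angle (f1 x) (f2 x) (f3 x)) has_derivative
    (\<lambda>h. (d1 h - (C1 * C2 - C3) / (C2\<^sup>2 - 1) * d2 h - (C1 * C3 - C2) / (C3\<^sup>2 - 1) * d3 h)
         / sqrt (triangle_det C1 C2 C3))) (at x)"
proof -
  define S2 S3 A y where "S2 = sqrt (C2\<^sup>2 - 1)" "S3 = sqrt (C3\<^sup>2 - 1)"
    "A = sqrt (triangle_det C1 C2 C3)" "y = (C2 * C3 - C1) / (S2 * S3)"
  note defs = S2_S3_A_y_def
  have gt: "0 < C2\<^sup>2 - 1" "0 < C3\<^sup>2 - 1" using C by (simp_all add: power2_gt_1_iff)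
  have S: "0 < S2" "0 < S3" "0 < A" using gt det by (simp_all add: defs)
  have S2: "S2 * S2 = C2\<^sup>2 - 1" "S3 * S3 = C3\<^sup>2 - 1"
    and S2': "S2\<^sup>2 = C2\<^sup>2 - 1" "S3\<^sup>2 = C3\<^sup>2 - 1" using gt by (simp_all add: defs)
  have A2: "A\<^sup>2 = (S2 * S3)\<^sup>2 - (C2 * C3 - C1)\<^sup>2"
    using det by (simp add: defs triangle_det_eq power_mult_distrib S2'[unfolded defs])
  have "1 - y\<^sup>2 = A\<^sup>2 / (S2 * S3)\<^sup>2"
    unfolding A2 defs(4) power_divide using S by (simp add: diff_divide_distrib)
  then have sq: "sqrt (1 - y\<^sup>2) = A / (S2 * S3)" using S by (simp add: real_sqrt_divide)
  have "0 < 1 - y\<^sup>2" using S \<open>1 - y\<^sup>2 = _\<close> by simp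
  then have "\<bar>y\<bar> < 1" by (simp add: abs_square_less_1)
  then have y: "- 1 < y" "y < 1" by auto
  have dr: "((\<lambda>x. (f2 x * f3 x - f1 x) / (sqrt ((f2 x)\<^sup>2 - 1) * sqrt ((f3 x)\<^sup>2 - 1))) has_derivative
     (\<lambda>h. (C3 * d2 h + C2 * d3 h - d1 h) / (S2 * S3)
        - y * (C2 * d2 h / (C2\<^sup>2 - 1) + C3 * d3 h / (C3\<^sup>2 - 1)))) (at x)"
  proof -
    have p2: "((\<lambda>x. sqrt ((f2 x)\<^sup>2 - 1)) has_derivative (\<lambda>h. C2 * d2 h / S2)) (at x)"
      using gt d C by (auto intro!: derivative_eq_intros simp: defs field_simps)
    have p3: "((\<lambda>x. sqrt ((f3 x)\<^sup>2 - 1)) has_derivative (\<lambda>h. C3 * d3 h / S3)) (at x)"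
      using gt d C by (auto intro!: derivative_eq_intros simp: defs field_simps)
    have "((\<lambda>x. (f2 x * f3 x - f1 x) / (sqrt ((f2 x)\<^sup>2 - 1) * sqrt ((f3 x)\<^sup>2 - 1))) has_derivative
      (\<lambda>h. ((C2 * d3 h + d2 h * C3 - d1 h) * (S2 * S3)
        - (C2 * C3 - C1) * (S2 * (C3 * d3 h / S3) + C2 * d2 h / S2 * S3)) / ((S2 * S3) * (S2 * S3)))) (at x)"
    proof -
      have n: "((\<lambda>x. f2 x * f3 x - f1 x) has_derivative (\<lambda>h. C2 * d3 h + d2 h * C3 - d1 h)) (at x)"
        using has_derivative_diff[OF has_derivative_mult[OF d(2,3)] d(1)] by (simp add: C)
      have m: "((\<lambda>x. sqrt ((f2 x)\<^sup>2 - 1) * sqrt ((f3 x)\<^sup>2 - 1)) has_derivative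
          (\<lambda>h. S2 * (C3 * d3 h / S3) + C2 * d2 h / S2 * S3)) (at x)"
        using has_derivative_mult[OF p2 p3] by (simp add: C defs(1,2))
      have "sqrt ((f2 x)\<^sup>2 - 1) = S2" "sqrt ((f3 x)\<^sup>2 - 1) = S3" by (simp_all add: C defs(1,2))
      then show ?thesis
        using has_derivative_divide'[OF n m] S by (simp add: C)
    qed
    moreover have "((C2 * d3 h + d2 h * C3 - d1 h) * (S2 * S3)
        - (C2 * C3 - C1) * (S2 * (C3 * d3 h / S3) + C2 * d2 h / S2 * S3)) / ((S2 * S3) * (S2 * S3))
      = (C3 * d2 h + C2 * d3 h - d1 h) / (S2 * S3)
        - y * (C2 * d2 h / (C2\<^sup>2 - 1) + C3 * d3 h / (C3\<^sup>2 - 1))" for h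
      using S unfolding S2'[symmetric] defs(4) by (simp add: field_simps power2_eq_square)
    ultimately show ?thesis by simp
  qed
  have "((\<lambda>x. cosine_angle (f1 x) (f2 x) (f3 x)) has_derivative
      (\<lambda>h. ((C3 * d2 h + C2 * d3 h - d1 h) / (S2 * S3)
        - y * (C2 * d2 h / (C2\<^sup>2 - 1) + C3 * d3 h / (C3\<^sup>2 - 1))) * (- 1 / sqrt (1 - y\<^sup>2)))) (at x)"
    unfolding cosine_angle_def
    by (rule DERIV_compose_FDERIV[OF _ dr])
      (use has_real_derivative_arccos_clamp[OF y] C in \<open>simp add: defs\<close>)
  moreover have "((C3 * d2 h + C2 * d3 h - d1 h) / (S2 * S3)
        - y * (C2 * d2 h / (C2\<^sup>2 - 1) + C3 * d3 h / (C3\<^sup>2 - 1))) * (- 1 / sqrt (1 - y\<^sup>2))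
      = (d1 h - (C1 * C2 - C3) / (C2\<^sup>2 - 1) * d2 h - (C1 * C3 - C2) / (C3\<^sup>2 - 1) * d3 h) / A" for h
  proof -
    have "((C3 * d2 h + C2 * d3 h - d1 h) / (S2 * S3)
        - y * (C2 * d2 h / (C2\<^sup>2 - 1) + C3 * d3 h / (C3\<^sup>2 - 1))) * (- 1 / sqrt (1 - y\<^sup>2))
       = (d1 h - C3 * d2 h - C2 * d3 h
          + (C2 * C3 - C1) * (C2 * d2 h / (C2\<^sup>2 - 1) + C3 * d3 h / (C3\<^sup>2 - 1))) / A"
    proof -
      have "(N / p - m / p * Z) * (- 1 / (A / p)) = (m * Z - N) / A" if "0 < p" for N m Z p
        using that S by (simp add: field_simps)
      moreover have "N - (d + (e - f)) = f - e - d + N" for N d e f :: real by simp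
      ultimately show ?thesis
        unfolding sq unfolding defs(4) using S by (simp only: mult_pos_pos) (simp add: add.commute)
    qed
    also have "d1 h - C3 * d2 h - C2 * d3 h
          + (C2 * C3 - C1) * (C2 * d2 h / (C2\<^sup>2 - 1) + C3 * d3 h / (C3\<^sup>2 - 1))
        = d1 h - (C1 * C2 - C3) / (C2\<^sup>2 - 1) * d2 h - (C1 * C3 - C2) / (C3\<^sup>2 - 1) * d3 h"
    proof -
      have "(C2 * C3 - C1) * C2 / (C2\<^sup>2 - 1) = C3 - (C1 * C2 - C3) / (C2\<^sup>2 - 1)"
        "(C2 * C3 - C1) * C3 / (C3\<^sup>2 - 1) = C2 - (C1 * C3 - C2) / (C3\<^sup>2 - 1)"
        using gt by (simp_all add: field_simps power2_eq_square)
      moreover have "(C2 * C3 - C1) * (C2 * d2 h / (C2\<^sup>2 - 1) + C3 * d3 h / (C3\<^sup>2 - 1))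
          = (C2 * C3 - C1) * C2 / (C2\<^sup>2 - 1) * d2 h + (C2 * C3 - C1) * C3 / (C3\<^sup>2 - 1) * d3 h"
        by (simp add: distrib_left)
      ultimately show ?thesis by (simp only: left_diff_distrib)
    qed
    finally show ?thesis .
  qed
  ultimately show ?thesis by (simp add: defs(3))
qed

section \<open>Positivity of the angle form\<close>

lemma edge_form_pos:
  assumes "1 < C"
  shows "0 \<le> C * (x\<^sup>2 + y\<^sup>2) - 2 * x * (y::real)"
    and "x \<noteq> 0 \<or> y \<noteq> 0 \<Longrightarrow> 0 < C * (x\<^sup>2 + y\<^sup>2) - 2 * x * y"
proof -
  have "C * (x\<^sup>2 + y\<^sup>2) - 2 * x * y = (C - 1) * (x\<^sup>2 + y\<^sup>2) + (x - y)\<^sup>2"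
    by (simp add: power2_eq_square algebra_simps)
  moreover have "0 \<le> (C - 1) * (x\<^sup>2 + y\<^sup>2)" "x \<noteq> 0 \<or> y \<noteq> 0 \<Longrightarrow> 0 < (C - 1) * (x\<^sup>2 + y\<^sup>2)"
    using assms by (auto simp: sum_power2_gt_zero_iff)
  ultimately show "0 \<le> C * (x\<^sup>2 + y\<^sup>2) - 2 * x * y"
    "x \<noteq> 0 \<or> y \<noteq> 0 \<Longrightarrow> 0 < C * (x\<^sup>2 + y\<^sup>2) - 2 * x * y"
    by (smt (verit) zero_le_power2)+
qed

text \<open>The case of one non-positive weight \<open>b3\<close>. The hypotheses bound \<open>b1\<close> and \<open>b2\<close> below by multiples of
  \<open>- b3\<close>, and the form grows with \<open>b1\<close> and \<open>b2\<close>. At the extreme values of \<open>b1\<close> and \<open>b2\<close> the form is a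
  sum of two squares up to positive factors (the step \<open>key\<close>).\<close>

lemma dual_triangle_form_pos:
  fixes C1 C2 C3 x1 x2 x3 b1 b2 b3 :: real
  defines "a13 \<equiv> C1 * C3 - C2" and "a23 \<equiv> C2 * C3 - C1"
  assumes C: "1 < C1" "1 < C2" "1 < C3"
    and det: "0 < triangle_det C1 C2 C3"
    and b: "0 < b2 * a23 + b3 * (C3\<^sup>2 - 1)" "0 < b1 * a13 + b3 * (C3\<^sup>2 - 1)"
      and b3: "b3 \<le> 0" and b12: "0 < b1" "0 < b2"
    and x: "x1 \<noteq> 0 \<or> x2 \<noteq> 0 \<or> x3 \<noteq> 0"
  shows "0 < b1 * (C1 * (x2\<^sup>2 + x3\<^sup>2) - 2 * x2 * x3)
           + b2 * (C2 * (x1\<^sup>2 + x3\<^sup>2) - 2 * x1 * x3)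
           + b3 * (C3 * (x1\<^sup>2 + x2\<^sup>2) - 2 * x1 * x2)"
proof -
  define q1 q2 q3 where "q1 = C1 * (x2\<^sup>2 + x3\<^sup>2) - 2 * x2 * x3"
    "q2 = C2 * (x1\<^sup>2 + x3\<^sup>2) - 2 * x1 * x3" "q3 = C3 * (x1\<^sup>2 + x2\<^sup>2) - 2 * x1 * x2"
  define T where "T = C3\<^sup>2 - 1"
  have T: "0 < T" using C by (simp add: T_def power2_gt_1_iff)
  have a: "0 < a23" "0 < a13"
    using b b3 b12 T by (auto simp: T_def[symmetric] zero_less_mult_iff)
      (smt (verit) mult_nonpos_nonneg mult_nonneg_nonpos)+
  \<comment> \<open>The excess of \<open>b1\<close> and \<open>b2\<close> over the extreme values at which the form is only
    semidefinite.\<close>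
  define e1 e2 where "e1 = b1 + b3 * T / a13" "e2 = b2 + b3 * T / a23"
  have e: "0 < e1" "0 < e2" using a b by (simp_all add: e1_e2_def T_def field_simps)
  have q: "0 \<le> q1" "0 \<le> q2" and q': "0 < q1 \<or> 0 < q2"
    using edge_form_pos[OF C(1), of x2 x3] edge_form_pos[OF C(2), of x1 x3] x
    by (auto simp: q1_q2_q3_def)
  have key: "T * (a23 * q1 + a13 * q2) - a13 * a23 * q3
     = (a13 * x1 + a23 * x2 - T * x3)\<^sup>2 + T * triangle_det C1 C2 C3 * x3\<^sup>2"
    unfolding q1_q2_q3_def T_def a13_def a23_def triangle_det_def
    by (simp add: power2_eq_square algebra_simps)
  have "b1 * q1 + b2 * q2 + b3 * q3 = e1 * q1 + e2 * q2
      + (- b3 / (a13 * a23)) * (T * (a23 * q1 + a13 * q2) - a13 * a23 * q3)"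
    using a by (simp add: e1_e2_def field_simps)
  moreover have "0 < e1 * q1 + e2 * q2"
    using e q q' by (metis add_nonneg_pos add_pos_nonneg less_imp_le mult_nonneg_nonneg mult_pos_pos)
  moreover have "0 \<le> (- b3 / (a13 * a23)) * (T * (a23 * q1 + a13 * q2) - a13 * a23 * q3)"
    unfolding key using a T det b3 by (intro mult_nonneg_nonneg divide_nonneg_pos add_nonneg_nonneg) auto
  ultimately show ?thesis unfolding q1_q2_q3_def by linarith
qed

text \<open>Here \<open>T\<^sub>k = (sinh l\<^sub>k)\<^sup>2\<close>, the \<open>a\<^sub>i\<^sub>j\<close> are the off-diagonal cofactors of the matrix with determinant
  \<open>D = triangle_det C1 C2 C3\<close>, and the \<open>b\<^sub>k * T\<^sub>k\<close> are the entries of the cofactor matrix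
  applied to the vector of the \<open>c\<^sub>i = cosh r\<^sub>i\<close>. Eliminating, the combination of two weights becomes a multiple of \<open>c1 * C2 - c3\<close>,
  which is positive when the inversive distance is non-negative.\<close>

lemma dual_weight_pos:
  fixes a12 a13 a23 T2 T3 D b2 b3 c1 c2 c3 C2 :: real
  assumes cof: "a12 * a23 + T2 * a13 = C2 * D" "T2 * T3 - a23\<^sup>2 = D"
    and b: "b2 * T2 = a12 * c1 + a23 * c3 - c2 * T2" "b3 * T3 = a13 * c1 + a23 * c2 - c3 * T3"
    and pos: "0 < T2" "0 < D" "c3 < c1 * C2"
  shows "0 < b2 * a23 + b3 * T3"
proof -
  have "T2 * (b2 * a23 + b3 * T3) = (b2 * T2) * a23 + T2 * (b3 * T3)"
    by (simp add: algebra_simps)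
  also have "\<dots> = c1 * (a12 * a23 + T2 * a13) - c3 * (T2 * T3 - a23\<^sup>2)"
    unfolding b by (simp add: power2_eq_square algebra_simps)
  also have "\<dots> = (c1 * C2 - c3) * D"
    unfolding cof by (simp add: algebra_simps)
  also have "\<dots> > 0" using pos by simp
  finally show ?thesis using pos by (simp add: zero_less_mult_iff)
qed

text \<open>Two non-positive weights would force \<open>a\<close> to be so negative that \<open>a\<^sup>2 > T2 * T3\<close>, that is, the
  cosine of an angle of the triangle would be less than \<open>- 1\<close>.\<close>

lemma dual_weights_not_both_nonpos:
  fixes a b2 b3 T2 T3 :: real
  assumes b: "0 < b2 * a + b3 * T3" "0 < b3 * a + b2 * T2"
    and T: "0 < T2" "0 < T3" and aT: "a\<^sup>2 < T2 * T3"
  shows "0 < b2 \<or> 0 < b3"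
proof (rule ccontr)
  assume "\<not> ?thesis"
  then have n: "b2 \<le> 0" "b3 \<le> 0" by auto
  have nn: "0 \<le> - b3 * T3" "0 \<le> - b2 * T2"
    using n T by (simp_all add: mult_nonpos_nonneg)
  have b': "- b3 * T3 < b2 * a" "- b2 * T2 < b3 * a" using b by simp_all
  have "(- b3 * T3) * (- b2 * T2) < (b2 * a) * (b3 * a)"
    by (rule mult_strict_mono'[OF b' nn])
  then have "(b2 * b3) * (T2 * T3) < (b2 * b3) * a\<^sup>2"
    by (simp add: power2_eq_square mult_ac)
  moreover have "0 \<le> b2 * b3" using n by (simp add: mult_nonpos_nonpos)
  ultimately show False using aT by (simp add: mult_less_cancel_left)
qed

text \<open>The form is \<open>sqrt (triangle_det C1 C2 C3)\<close> times the pairing of a direction \<open>(x1, x2, x3)\<close> in the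
  dual radii with the derivative of the three angles; \<open>d1\<close>, \<open>d2\<close> and \<open>d3\<close> are the derivatives of the
  hyperbolic cosines of the edge lengths in that direction. It is positive because it equals
  \<open>b1 * q1 + b2 * q2 + b3 * q3\<close> for the weights below, and at most one of the weights fails to be
  positive.\<close>

lemma dual_angle_form_pos:
  fixes c1 c2 c3 C1 C2 C3 x1 x2 x3 :: real
  assumes C: "1 < C1" "1 < C2" "1 < C3"
    and det: "0 < triangle_det C1 C2 C3"
    and c: "c3 < c1 * C2" "c2 < c1 * C3" "c3 < c2 * C1" "c1 < c2 * C3" "c2 < c3 * C1" "c1 < c3 * C2"
    and x: "x1 \<noteq> 0 \<or> x2 \<noteq> 0 \<or> x3 \<noteq> 0"
  defines "d1 \<equiv> - ((c2 * C1 - c3) * x2 + (c3 * C1 - c2) * x3)"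
    and "d2 \<equiv> - ((c1 * C2 - c3) * x1 + (c3 * C2 - c1) * x3)"
    and "d3 \<equiv> - ((c1 * C3 - c2) * x1 + (c2 * C3 - c1) * x2)"
  shows "0 < x1 * (d1 - (C1 * C2 - C3) / (C2\<^sup>2 - 1) * d2 - (C1 * C3 - C2) / (C3\<^sup>2 - 1) * d3)
           + x2 * (d2 - (C1 * C2 - C3) / (C1\<^sup>2 - 1) * d1 - (C2 * C3 - C1) / (C3\<^sup>2 - 1) * d3)
           + x3 * (d3 - (C1 * C3 - C2) / (C1\<^sup>2 - 1) * d1 - (C2 * C3 - C1) / (C2\<^sup>2 - 1) * d2)"
proof -
  \<comment> \<open>Up to the positive factors \<open>D / T\<^sub>k\<close>, with \<open>D\<close> and \<open>T\<^sub>k\<close> as defined next, the weights are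
    the barycentric coordinates of the radical centre.\<close>
  define b1 b2 b3 where
    "b1 = ((C1 * C2 - C3) * c2 + (C1 * C3 - C2) * c3) / (C1\<^sup>2 - 1) - c1"
    "b2 = ((C1 * C2 - C3) * c1 + (C2 * C3 - C1) * c3) / (C2\<^sup>2 - 1) - c2"
    "b3 = ((C1 * C3 - C2) * c1 + (C2 * C3 - C1) * c2) / (C3\<^sup>2 - 1) - c3"
  note bs = b1_b2_b3_def
  define a12 a13 a23 T1 T2 T3 D where "a12 = C1 * C2 - C3" "a13 = C1 * C3 - C2" "a23 = C2 * C3 - C1"
    "T1 = C1\<^sup>2 - 1" "T2 = C2\<^sup>2 - 1" "T3 = C3\<^sup>2 - 1" "D = triangle_det C1 C2 C3"
  note defs = a12_a13_a23_T1_T2_T3_D_def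
  have T: "0 < T1" "0 < T2" "0 < T3" "0 < D"
    using C det by (simp_all add: defs power2_gt_1_iff)
  have dets: "triangle_det C1 C3 C2 = triangle_det C1 C2 C3" "triangle_det C3 C2 C1 = triangle_det C1 C2 C3"
    by (simp_all add: triangle_det_def)
  have cof: "a12 * a23 + T2 * a13 = C2 * D" "a13 * a23 + T3 * a12 = C3 * D"
    "a12 * a13 + T1 * a23 = C1 * D" "a23 * a13 + T3 * a12 = C3 * D"
    "a13 * a12 + T1 * a23 = C1 * D" "a23 * a12 + T2 * a13 = C2 * D"
    by (simp_all add: defs triangle_det_def power2_eq_square algebra_simps)
  have cof': "T2 * T3 - a23\<^sup>2 = D" "T3 * T2 - a23\<^sup>2 = D" "T1 * T3 - a13\<^sup>2 = D"
    "T3 * T1 - a13\<^sup>2 = D" "T1 * T2 - a12\<^sup>2 = D" "T2 * T1 - a12\<^sup>2 = D"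
    by (simp_all add: defs triangle_det_def power2_eq_square algebra_simps)
  have b: "b1 * T1 = a12 * c2 + a13 * c3 - c1 * T1" "b1 * T1 = a13 * c3 + a12 * c2 - c1 * T1"
    "b2 * T2 = a12 * c1 + a23 * c3 - c2 * T2" "b2 * T2 = a23 * c3 + a12 * c1 - c2 * T2"
    "b3 * T3 = a13 * c1 + a23 * c2 - c3 * T3" "b3 * T3 = a23 * c2 + a13 * c1 - c3 * T3"
    using T unfolding bs defs[symmetric] by (simp_all add: left_diff_distrib)
  have p23: "0 < b2 * a23 + b3 * T3" by (rule dual_weight_pos[OF cof(1) cof'(1) b(3) b(5) T(2) T(4) c(1)])
  have p32: "0 < b3 * a23 + b2 * T2" by (rule dual_weight_pos[OF cof(2) cof'(2) b(5) b(3) T(3) T(4) c(2)])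
  have p13: "0 < b1 * a13 + b3 * T3" by (rule dual_weight_pos[OF cof(3) cof'(3) b(1) b(6) T(1) T(4) c(3)])
  have p31: "0 < b3 * a13 + b1 * T1" by (rule dual_weight_pos[OF cof(4) cof'(4) b(6) b(1) T(3) T(4) c(4)])
  have p12: "0 < b1 * a12 + b2 * T2" by (rule dual_weight_pos[OF cof(5) cof'(5) b(2) b(4) T(1) T(4) c(5)])
  have p21: "0 < b2 * a12 + b1 * T1" by (rule dual_weight_pos[OF cof(6) cof'(6) b(4) b(2) T(2) T(4) c(6)])
  have two: "0 < b2 \<or> 0 < b3" "0 < b1 \<or> 0 < b3" "0 < b1 \<or> 0 < b2"
    using dual_weights_not_both_nonpos[OF p23 p32 T(2,3)] dual_weights_not_both_nonpos[OF p13 p31 T(1,3)]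
      dual_weights_not_both_nonpos[OF p12 p21 T(1,2)] cof' T(4) by linarith+
  define q1 q2 q3 where "q1 = C1 * (x2\<^sup>2 + x3\<^sup>2) - 2 * x2 * x3"
    "q2 = C2 * (x1\<^sup>2 + x3\<^sup>2) - 2 * x1 * x3" "q3 = C3 * (x1\<^sup>2 + x2\<^sup>2) - 2 * x1 * x2"
  have "0 < b1 * q1 + b2 * q2 + b3 * q3"
  proof -
    consider "b1 \<le> 0" | "b2 \<le> 0" | "b3 \<le> 0" | "0 < b1" "0 < b2" "0 < b3" by linarith
    then show ?thesis
    proof cases
      case 1
      then have "0 < b3 * (C3 * (x2\<^sup>2 + x1\<^sup>2) - 2 * x2 * x1)
           + b2 * (C2 * (x3\<^sup>2 + x1\<^sup>2) - 2 * x3 * x1)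
           + b1 * (C1 * (x3\<^sup>2 + x2\<^sup>2) - 2 * x3 * x2)"
        using C det two x p21 p31
        by (intro dual_triangle_form_pos) (auto simp: dets defs mult.commute)
      then show ?thesis by (simp add: q1_q2_q3_def add_ac mult_ac)
    next
      case 2
      then have "0 < b1 * (C1 * (x3\<^sup>2 + x2\<^sup>2) - 2 * x3 * x2)
           + b3 * (C3 * (x1\<^sup>2 + x2\<^sup>2) - 2 * x1 * x2)
           + b2 * (C2 * (x1\<^sup>2 + x3\<^sup>2) - 2 * x1 * x3)"
        using C det two x p12 p32
        by (intro dual_triangle_form_pos) (auto simp: dets defs mult.commute)
      then show ?thesis by (simp add: q1_q2_q3_def add_ac mult_ac)
    next
      case 3
      then show ?thesis
        unfolding q1_q2_q3_def using C det two x p13 p23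
        by (intro dual_triangle_form_pos) (auto simp: dets defs mult.commute)
    next
      case 4
      have "0 \<le> q1" "0 \<le> q2" "0 \<le> q3" using edge_form_pos C by (auto simp: q1_q2_q3_def)
      moreover have "0 < q1 \<or> 0 < q2" using edge_form_pos(2)[OF C(1), of x2 x3] edge_form_pos(2)[OF C(2), of x1 x3] x by (auto simp: q1_q2_q3_def)
      ultimately show ?thesis using 4
        by (smt (verit) mult_nonneg_nonneg mult_pos_pos)
    qed
  qed
  also have "b1 * q1 + b2 * q2 + b3 * q3 =
           x1 * (d1 - (C1 * C2 - C3) / (C2\<^sup>2 - 1) * d2 - (C1 * C3 - C2) / (C3\<^sup>2 - 1) * d3)
           + x2 * (d2 - (C1 * C2 - C3) / (C1\<^sup>2 - 1) * d1 - (C2 * C3 - C1) / (C3\<^sup>2 - 1) * d3)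
           + x3 * (d3 - (C1 * C3 - C2) / (C1\<^sup>2 - 1) * d1 - (C2 * C3 - C1) / (C2\<^sup>2 - 1) * d2)"
  proof -
    \<comment> \<open>Between \<open>k\<^sub>i\<^sub>j\<close> and the hyperbolic cosines there are six linear relations, which reduce the
      comparison of coefficients to polynomial arithmetic.\<close>
    define k12 k13 k21 k23 k31 k32 where
      "k12 = (C1 * C2 - C3) / (C1\<^sup>2 - 1)" "k13 = (C1 * C3 - C2) / (C1\<^sup>2 - 1)"
      "k21 = (C1 * C2 - C3) / (C2\<^sup>2 - 1)" "k23 = (C2 * C3 - C1) / (C2\<^sup>2 - 1)"
      "k31 = (C1 * C3 - C2) / (C3\<^sup>2 - 1)" "k32 = (C2 * C3 - C1) / (C3\<^sup>2 - 1)"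
    note ks = k12_k13_k21_k23_k31_k32_def
    have T': "C1\<^sup>2 - 1 \<noteq> 0" "C2\<^sup>2 - 1 \<noteq> 0" "C3\<^sup>2 - 1 \<noteq> 0" using T by (simp_all add: defs)
    have r: "k12 + C1 * k13 = C3" "k13 + C1 * k12 = C2" "k21 + C2 * k23 = C3" "k23 + C2 * k21 = C1"
      "k31 + C3 * k32 = C2" "k32 + C3 * k31 = C1"
      using T' by (simp_all add: ks add_divide_distrib[symmetric] divide_eq_eq del: right_minus_eq) (simp_all add: power2_eq_square algebra_simps)
    have b': "b1 = k12 * c2 + k13 * c3 - c1" "b2 = k21 * c1 + k23 * c3 - c2" "b3 = k31 * c1 + k32 * c2 - c3"
      by (simp_all add: bs ks add_divide_distrib)
    have "b1 * q1 + b2 * q2 + b3 * q3 =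
        x1 * (d1 - k21 * d2 - k31 * d3) + x2 * (d2 - k12 * d1 - k32 * d3) + x3 * (d3 - k13 * d1 - k23 * d2)"
      (is "?L = ?R")
    proof -
      have z: "k12 + C1 * k13 - C3 = 0" "k13 + C1 * k12 - C2 = 0" "k21 + C2 * k23 - C3 = 0"
        "k23 + C2 * k21 - C1 = 0" "k31 + C3 * k32 - C2 = 0" "k32 + C3 * k31 - C1 = 0"
        using r by simp_all
      have "?L - ?R =
          (c2 * x3\<^sup>2 - c3 * x2 * x3) * (k13 + C1 * k12 - C2) + (c3 * x2\<^sup>2 - c2 * x2 * x3) * (k12 + C1 * k13 - C3)
        + (c1 * x3\<^sup>2 - c3 * x1 * x3) * (k23 + C2 * k21 - C1) + (c3 * x1\<^sup>2 - c1 * x1 * x3) * (k21 + C2 * k23 - C3)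
        + (c1 * x2\<^sup>2 - c2 * x1 * x2) * (k32 + C3 * k31 - C1) + (c2 * x1\<^sup>2 - c1 * x1 * x2) * (k31 + C3 * k32 - C2)"
        unfolding b' d1_def d2_def d3_def q1_q2_q3_def by (simp add: power2_eq_square algebra_simps)
      then have "?L - ?R = 0" unfolding z by simp
      then show "?L = ?R" by simp
    qed
    then show ?thesis by (simp only: ks)
  qed
  finally show ?thesis .
qed

section \<open>Solutions of dissipative equations\<close>

primrec euler :: "('a::real_vector \<Rightarrow> 'a) \<Rightarrow> 'a \<Rightarrow> real \<Rightarrow> nat \<Rightarrow> 'a" where
  "euler G x h 0 = x"
| "euler G x h (Suc n) = euler G x h n + h *\<^sub>R G (euler G x h n)"

lemma euler_mem:
  assumes "x \<in> K" "\<And>y. y \<in> K \<Longrightarrow> y + h *\<^sub>R G y \<in> K"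
  shows "euler G x h n \<in> K"
  by (induction n) (use assms in auto)

text \<open>For \<open>p = 0\<close> this is a Lipschitz bound; for \<open>p\<close> a value of the field nearby it compares the polygon
  with its tangent, which yields the derivative of the limit.\<close>

lemma euler_increment:
  fixes G :: "'a::real_normed_vector \<Rightarrow> 'a"
  assumes "0 \<le> h" "m \<le> n" and "\<And>j. m \<le> j \<Longrightarrow> j < n \<Longrightarrow> norm (G (euler G x h j) - p) \<le> \<epsilon>"
  shows "norm (euler G x h n - euler G x h m - (real n * h - real m * h) *\<^sub>R p) \<le> \<epsilon> * (real n * h - real m * h)"
  using assms(2,3)
proof (induction n rule: dec_induct)
  case base
  then show ?case by simp
next
  case (step n)
  have "norm (euler G x h n - euler G x h m - (real n * h - real m * h) *\<^sub>R p) \<le> \<epsilon> * (real n * h - real m * h)"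
    using step by auto
  moreover have "norm (h *\<^sub>R (G (euler G x h n) - p)) \<le> \<epsilon> * h"
  proof -
    have "norm (G (euler G x h n) - p) \<le> \<epsilon>" using step by auto
    then have "norm (G (euler G x h n) - p) * h \<le> \<epsilon> * h" by (rule mult_right_mono[OF _ assms(1)])
    then show ?thesis using assms(1) by (simp add: mult.commute)
  qed
  ultimately have "norm ((euler G x h n - euler G x h m - (real n * h - real m * h) *\<^sub>R p)
      + h *\<^sub>R (G (euler G x h n) - p)) \<le> \<epsilon> * (real n * h - real m * h) + \<epsilon> * h"
    by (rule norm_triangle_mono)
  then show ?case by (simp add: algebra_simps)
qed

text \<open>Interpolate the coarse polygon linearly at the nodes of the fine one and follow the squared distance:
  one fine step increases it by at most \<open>8 * h * k * B\<^sup>2\<close>, since dissipativity discards the first-order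
  term up to the distance \<open>h * B\<close> between the coarse node and the interpolated point.\<close>

lemma euler_refinement:
  fixes G :: "'a::real_inner \<Rightarrow> 'a"
  assumes k: "0 < k" and m: "0 < m"
    and x: "x \<in> K" and step: "\<And>y h'. y \<in> K \<Longrightarrow> 0 \<le> h' \<Longrightarrow> h' \<le> real m * k \<Longrightarrow> y + h' *\<^sub>R G y \<in> K"
    and B: "\<And>y. y \<in> K \<Longrightarrow> norm (G y) \<le> B"
    and diss: "\<And>y z. y \<in> K \<Longrightarrow> z \<in> K \<Longrightarrow> (y - z) \<bullet> (G y - G z) \<le> 0"
  shows "norm (euler G x (real m * k) (N div m) - euler G x k N)
    \<le> real m * k * B + sqrt (8 * (real m * k) * B\<^sup>2 * (real N * k))"
proof -
  define h where "h = real m * k"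
  have h: "0 < h" "k \<le> h" using k m by (simp_all add: h_def)
  have B0: "0 \<le> B" using B[OF x] norm_ge_zero order_trans by blast
  \<comment> \<open>\<open>z N\<close> is the last coarse node before the fine node \<open>e N\<close>, and \<open>a N\<close> the point of the coarse
    polygon at the same time.\<close>
  define z where "z N = euler G x h (N div m)" for N
  define a where "a N = z N + (real (N mod m) * k) *\<^sub>R G (z N)" for N
  define e where "e N = euler G x k N" for N
  have zK: "z N \<in> K" for N unfolding z_def using h by (intro euler_mem x step) (auto simp: h_def)
  have eK: "e N \<in> K" for N unfolding e_def using h k by (intro euler_mem x step) (auto simp: h_def)
  have a_Suc: "a (Suc N) = a N + k *\<^sub>R G (z N)" for N
  proof (cases "Suc (N mod m) = m")
    case True
    then have "Suc N mod m = 0" "Suc N div m = Suc (N div m)" by (simp_all add: mod_Suc div_Suc)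
    moreover have "(real (N mod m) * k) *\<^sub>R G (z N) + k *\<^sub>R G (z N) = h *\<^sub>R G (z N)"
    proof -
      have "real m = real (N mod m) + 1" using True by (metis of_nat_Suc add.commute)
      then show ?thesis by (simp add: h_def algebra_simps)
    qed
    ultimately show ?thesis by (simp add: a_def z_def add.assoc)
  next
    case False
    then have "Suc N mod m = Suc (N mod m)" "Suc N div m = N div m" by (simp_all add: mod_Suc div_Suc)
    then show ?thesis by (simp add: a_def z_def algebra_simps)
  qed
  have az: "norm (a N - z N) \<le> h * B" for N
  proof -
    have "real (N mod m) * k \<le> real m * k" using m k by (intro mult_right_mono) auto
    then have "real (N mod m) * k * norm (G (z N)) \<le> h * B"
      using B[OF zK] k B0 by (intro mult_mono) (auto simp: h_def)
    then show ?thesis using k by (simp add: a_def)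
  qed
  have main: "(norm (a N - e N))\<^sup>2 \<le> 8 * h * B\<^sup>2 * (real N * k)" for N
  proof (induction N)
    case 0
    show ?case by (simp add: a_def z_def e_def)
  next
    case (Suc N)
    define w where "w = G (z N) - G (e N)"
    have wB: "norm w \<le> 2 * B"
      using norm_triangle_ineq4[of "G (z N)" "G (e N)"] B[OF zK, of N] B[OF eK, of N] by (simp add: w_def)
    have "(a N - e N) \<bullet> w = (a N - z N) \<bullet> w + (z N - e N) \<bullet> w"
      by (simp add: inner_diff_left)
    also have "(a N - z N) \<bullet> w \<le> h * B * (2 * B)"
      using norm_cauchy_schwarz[of "a N - z N" w] mult_mono[OF az wB] h B0
      by (meson mult_nonneg_nonneg norm_ge_zero order_trans less_imp_le)
    also have "(z N - e N) \<bullet> w \<le> 0" unfolding w_def by (rule diss[OF zK eK])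
    finally have in1: "(a N - e N) \<bullet> w \<le> 2 * h * B\<^sup>2" by (simp add: power2_eq_square)
    have "(norm w)\<^sup>2 \<le> 4 * B\<^sup>2" using power_mono[OF wB norm_ge_zero, of 2] by (simp add: power_mult_distrib)
    then have "k * (norm w)\<^sup>2 \<le> h * (4 * B\<^sup>2)" using h k by (intro mult_mono) auto
    have expand: "(norm (d + k *\<^sub>R w))\<^sup>2 = (norm d)\<^sup>2 + k * (2 * (d \<bullet> w) + k * (norm w)\<^sup>2)" for d
      by (simp add: power2_norm_eq_inner inner_add_left inner_add_right inner_commute algebra_simps)
    have "a (Suc N) - e (Suc N) = (a N - e N) + k *\<^sub>R w"
      by (simp add: a_Suc e_def w_def algebra_simps)
    then have "(norm (a (Suc N) - e (Suc N)))\<^sup>2 = (norm (a N - e N))\<^sup>2 + k * (2 * ((a N - e N) \<bullet> w) + k * (norm w)\<^sup>2)"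
      by (simp only: expand)
    also have "\<dots> \<le> 8 * h * B\<^sup>2 * (real N * k) + k * (2 * (2 * h * B\<^sup>2) + h * (4 * B\<^sup>2))"
      using Suc in1 \<open>k * (norm w)\<^sup>2 \<le> _\<close> k by (intro add_mono mult_left_mono) auto
    also have "\<dots> = 8 * h * B\<^sup>2 * (real (Suc N) * k)" by (simp add: algebra_simps)
    finally show ?case .
  qed
  have "norm (a N - e N) \<le> sqrt (8 * h * B\<^sup>2 * (real N * k))"
    using main[of N] real_le_rsqrt by blast
  then have "norm ((z N - a N) + (a N - e N)) \<le> h * B + sqrt (8 * h * B\<^sup>2 * (real N * k))"
    using az[of N] by (intro norm_triangle_mono) (simp_all add: norm_minus_commute)
  then show ?thesis by (simp add: z_def e_def h_def)
qed

lemma nat_floor_div: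
  assumes "0 < k" "0 \<le> t" "0 < m"
  shows "nat \<lfloor>t / k\<rfloor> div m = nat \<lfloor>t / (real m * k)\<rfloor>"
proof -
  have "\<lfloor>t / k\<rfloor> div int m = \<lfloor>t / k / real m\<rfloor>"
    using floor_divide_real_eq_div[of "int m" "t / k"] by simp
  also have "t / k / real m = t / (real m * k)" by (simp add: mult.commute)
  finally show ?thesis using assms by (metis nat_div_distrib nat_int zero_le_divide_iff less_imp_le zero_le_floor)
qed

text \<open>Euler steps of length \<open>h0 / 2 ^ n\<close> are nested, so the refinement estimate makes the step functions
  converge at every time; continuity of the field identifies the derivative of the limit. The
  assumption on \<open>K\<close> says that short Euler steps do not leave \<open>K\<close>.\<close>

lemma dissipative_flow_exists:
  fixes G :: "'a::{real_inner,banach} \<Rightarrow> 'a"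
  assumes K: "closed K" and cont: "continuous_on K G" and x: "x \<in> K"
    and h0: "0 < h0" and step: "\<And>y h. y \<in> K \<Longrightarrow> 0 \<le> h \<Longrightarrow> h \<le> h0 \<Longrightarrow> y + h *\<^sub>R G y \<in> K"
    and B: "\<And>y. y \<in> K \<Longrightarrow> norm (G y) \<le> B"
    and diss: "\<And>y z. y \<in> K \<Longrightarrow> z \<in> K \<Longrightarrow> (y - z) \<bullet> (G y - G z) \<le> 0"
  obtains v where "v 0 = x" "\<And>t. 0 \<le> t \<Longrightarrow> v t \<in> K"
    "\<And>t. 0 \<le> t \<Longrightarrow> (v has_vector_derivative G (v t)) (at t within {0..})"
proof -
  have B0: "0 \<le> B" using B[OF x] norm_ge_zero order_trans by blast
  define h where "h n = h0 / 2 ^ n" for n :: nat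
  have h: "0 < h n" "h n \<le> h0" for n using h0 by (simp_all add: h_def divide_le_eq mult_left_le)
  have h_lim: "h \<longlonglongrightarrow> 0"
    unfolding h_def using LIMSEQ_divide_realpow_zero[of 2 h0] by simp
  define c where "c n t = nat \<lfloor>t / h n\<rfloor>" for n t
  define u where "u n t = euler G x (h n) (c n t)" for n t
  have eK: "euler G x (h n) j \<in> K" for n j
    using h by (intro euler_mem x step) (auto intro: less_imp_le)
  have c_bounds: "real (c n t) * h n \<le> t" "t - h n \<le> real (c n t) * h n" if "0 \<le> t" for n t
  proof -
    have "real (c n t) = of_int \<lfloor>t / h n\<rfloor>" using that h[of n] by (simp add: c_def)
    then have "real (c n t) \<le> t / h n" "t / h n - 1 \<le> real (c n t)" by linarith+
    then show "real (c n t) * h n \<le> t" "t - h n \<le> real (c n t) * h n"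
      using h[of n] by (simp_all add: field_simps)
  qed
  have c_mono: "c n s \<le> c n t" if "s \<le> t" for n s t
    using that h[of n] by (auto simp: c_def intro!: nat_mono floor_mono divide_right_mono)
  have c_lim: "(\<lambda>n. real (c n t) * h n) \<longlonglongrightarrow> t" if "0 \<le> t" for t
  proof (rule tendsto_sandwich)
    show "\<forall>\<^sub>F n in sequentially. t - h n \<le> real (c n t) * h n"
      "\<forall>\<^sub>F n in sequentially. real (c n t) * h n \<le> t" using c_bounds[OF that] by simp_all
    show "(\<lambda>n. t - h n) \<longlonglongrightarrow> t" using tendsto_diff[OF tendsto_const h_lim, of t] by simp
  qed simp
  have close: "norm (u n t - u n' t) \<le> h n * B + sqrt (8 * h n * B\<^sup>2 * t)" if "0 \<le> t" "n \<le> n'" for n n' t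
  proof -
    define m where "m = (2::nat) ^ (n' - n)"
    have m: "0 < m" by (simp add: m_def)
    have "real m = 2 ^ n' / 2 ^ n" using that(2) by (simp add: m_def power_diff[symmetric])
    then have mh: "real m * h n' = h n" by (simp add: h_def)
    have "norm (u n t - u n' t) \<le> h n * B + sqrt (8 * h n * B\<^sup>2 * (real (c n' t) * h n'))"
    proof -
      have "c n' t div m = c n t"
        unfolding c_def using nat_floor_div[OF h(1)[of n'] that(1) m] by (simp add: mh)
      then show ?thesis
        using euler_refinement[of "h n'" m x K G B "c n' t"] h x m step B diss
        unfolding mh u_def by (smt (verit))
    qed
    also have "\<dots> \<le> h n * B + sqrt (8 * h n * B\<^sup>2 * t)"
      using c_bounds[OF that(1)] h[of n] by (intro add_left_mono real_sqrt_le_mono mult_left_mono) auto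
    finally show ?thesis .
  qed
  have "convergent (\<lambda>n. u n t)" if "0 \<le> t" for t
  proof -
    have "(\<lambda>n. h n * B + sqrt (8 * h n * B\<^sup>2 * t)) \<longlonglongrightarrow> 0 * B + sqrt (8 * 0 * B\<^sup>2 * t)"
      by (intro tendsto_intros h_lim)
    then have lim: "(\<lambda>n. h n * B + sqrt (8 * h n * B\<^sup>2 * t)) \<longlonglongrightarrow> 0" by simp
    have "Cauchy (\<lambda>n. u n t)"
    proof (rule metric_CauchyI)
      fix e :: real assume "0 < e"
      then have "\<forall>\<^sub>F n in sequentially. h n * B + sqrt (8 * h n * B\<^sup>2 * t) < e / 2"
        using order_tendstoD(2)[OF lim, of "e / 2"] by simp
      then obtain M where M: "h M * B + sqrt (8 * h M * B\<^sup>2 * t) < e / 2"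
        by (auto simp: eventually_sequentially)
      have "dist (u m t) (u n t) < e" if "m \<ge> M" "n \<ge> M" for m n
        using close[OF \<open>0 \<le> t\<close> that(1)] close[OF \<open>0 \<le> t\<close> that(2)] M
          dist_triangle_half_r[of "u M t" "u m t" e "u n t"] by (simp add: dist_norm)
      then show "\<exists>M. \<forall>m\<ge>M. \<forall>n\<ge>M. dist (u m t) (u n t) < e" by blast
    qed
    then show ?thesis by (rule Cauchy_convergent)
  qed
  then obtain v where v: "(\<lambda>n. u n t) \<longlonglongrightarrow> v t" if "0 \<le> t" for t
    unfolding convergent_def by metis
  have "v 0 = x"
  proof -
    have "u n 0 = x" for n by (simp add: u_def c_def)
    then show ?thesis using v[of 0] by (simp add: LIMSEQ_const_iff)
  qed
  moreover have vK: "v t \<in> K" if "0 \<le> t" for t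
    using closed_sequentially[OF K _ v[OF that]] eK by (simp add: u_def)
  moreover have "(v has_vector_derivative G (v t0)) (at t0 within {0..})" if t0: "0 \<le> t0" for t0
  proof -
    define p where "p = G (v t0)"
    have approx: "\<exists>\<rho>>0. \<forall>s\<ge>0. \<forall>t\<ge>s. \<bar>s - t0\<bar> < \<rho> \<longrightarrow> \<bar>t - t0\<bar> < \<rho> \<longrightarrow>
        norm (v t - v s - (t - s) *\<^sub>R p) \<le> \<epsilon> * (t - s)" if \<epsilon>: "0 < \<epsilon>" for \<epsilon>
    proof -
      obtain \<delta> where \<delta>: "0 < \<delta>" "\<And>y. y \<in> K \<Longrightarrow> dist y (v t0) < \<delta> \<Longrightarrow> dist (G y) p < \<epsilon>"
        using cont vK[OF t0] \<epsilon> unfolding continuous_on_iff p_def by metis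
      \<comment> \<open>Polygon nodes at times within \<open>2 * \<rho>\<close> of \<open>t0\<close> stay within \<open>\<delta> / 2\<close> of the node of \<open>t0\<close>; the
        factor \<open>B + 1\<close> allows \<open>B = 0\<close>.\<close>
      define \<rho> where "\<rho> = \<delta> / (4 * (B + 1))"
      have \<rho>: "0 < \<rho>" using \<delta> B0 by (simp add: \<rho>_def)
      have "norm (v t - v s - (t - s) *\<^sub>R p) \<le> \<epsilon> * (t - s)"
        if st: "0 \<le> s" "s \<le> t" "\<bar>s - t0\<bar> < \<rho>" "\<bar>t - t0\<bar> < \<rho>" for s t
      proof (rule tendsto_le)
        have t: "0 \<le> t" using st by simp
        show "(\<lambda>n. \<epsilon> * (real (c n t) * h n - real (c n s) * h n)) \<longlonglongrightarrow> \<epsilon> * (t - s)"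
          by (intro tendsto_intros c_lim st t)
        show "(\<lambda>n. norm (u n t - u n s - (real (c n t) * h n - real (c n s) * h n) *\<^sub>R p))
            \<longlonglongrightarrow> norm (v t - v s - (t - s) *\<^sub>R p)"
          by (intro tendsto_intros c_lim v st t)
        have "\<forall>\<^sub>F n in sequentially. h n < \<rho>" using order_tendstoD(2)[OF h_lim \<rho>] .
        moreover have "\<forall>\<^sub>F n in sequentially. dist (u n t0) (v t0) < \<delta> / 4"
          using tendstoD[OF v[OF t0], of "\<delta> / 4"] \<delta>(1) by simp
        ultimately show "\<forall>\<^sub>F n in sequentially.
            norm (u n t - u n s - (real (c n t) * h n - real (c n s) * h n) *\<^sub>R p)
            \<le> \<epsilon> * (real (c n t) * h n - real (c n s) * h n)"
        proof eventually_elim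
          case (elim n)
          have near: "norm (G (euler G x (h n) j) - p) \<le> \<epsilon>" if j: "c n s \<le> j" "j < c n t" for j
          proof -
            have "real (c n s) * h n \<le> real j * h n" "real j * h n \<le> real (c n t) * h n"
              using j h[of n] by (auto intro: mult_right_mono)
            then have jt: "\<bar>real j * h n - real (c n t0) * h n\<bar> \<le> 2 * \<rho>"
              using c_bounds[OF st(1), of n] c_bounds[OF t, of n] c_bounds[OF t0, of n] st elim(1)
              by linarith
            have lip: "norm (euler G x (h n) j' - euler G x (h n) i) \<le> B * (real j' * h n - real i * h n)"
              if "i \<le> j'" for i j'
              using euler_increment[of "h n" i j' G x 0 B] that h[of n] B[OF eK] by simp
            have "norm (euler G x (h n) j - u n t0) \<le> B * \<bar>real j * h n - real (c n t0) * h n\<bar>"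
            proof (cases "c n t0 \<le> j")
              case True
              then have "real (c n t0) * h n \<le> real j * h n" using h[of n] by (intro mult_right_mono) auto
              with lip[OF True] show ?thesis by (simp add: u_def)
            next
              case False
              then have le: "j \<le> c n t0" by simp
              then have "real j * h n \<le> real (c n t0) * h n" using h[of n] by (intro mult_right_mono) auto
              with lip[OF le] show ?thesis by (simp add: u_def norm_minus_commute)
            qed
            also have "\<dots> \<le> B * (2 * \<rho>)" by (rule mult_left_mono[OF jt B0])
            also have "\<dots> \<le> \<delta> / 2"
              using B0 \<delta>(1) by (simp add: \<rho>_def field_simps)
            finally have "dist (euler G x (h n) j) (v t0) < \<delta>"
              using elim(2) \<delta>(1) dist_triangle[of "euler G x (h n) j" "v t0" "u n t0"]
              by (simp add: dist_norm)
            then show ?thesis using \<delta>(2)[OF eK] by (auto simp: dist_norm intro: less_imp_le)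
          qed
          show ?case
            unfolding u_def using h[of n] c_mono[OF st(2)] near by (intro euler_increment) auto
        qed
      qed simp
      with \<rho> show ?thesis by blast
    qed
    show ?thesis
      unfolding has_vector_derivative_def has_derivative_within_alt
    proof (intro conjI allI impI)
      show "bounded_linear (\<lambda>s. s *\<^sub>R G (v t0))" by (rule bounded_linear_scaleR_left)
      fix \<epsilon> :: real assume "0 < \<epsilon>"
      from approx[OF this] obtain \<rho> where \<rho>: "\<rho> > 0" and ap: "\<And>s t. 0 \<le> s \<Longrightarrow> s \<le> t \<Longrightarrow>
        \<bar>s - t0\<bar> < \<rho> \<Longrightarrow> \<bar>t - t0\<bar> < \<rho> \<Longrightarrow> norm (v t - v s - (t - s) *\<^sub>R p) \<le> \<epsilon> * (t - s)" by blast
      show "\<exists>d>0. \<forall>y\<in>{0..}. norm (y - t0) < d \<longrightarrow>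
          norm (v y - v t0 - (y - t0) *\<^sub>R G (v t0)) \<le> \<epsilon> * norm (y - t0)"
      proof (intro exI[of _ \<rho>] conjI ballI impI \<rho>)
        fix y :: real assume y: "y \<in> {0..}" "norm (y - t0) < \<rho>"
        show "norm (v y - v t0 - (y - t0) *\<^sub>R G (v t0)) \<le> \<epsilon> * norm (y - t0)"
        proof (cases "t0 \<le> y")
          case True
          then show ?thesis using ap[of t0 y] t0 y \<rho> by (simp add: p_def)
        next
          case False
          have "v y - v t0 - (y - t0) *\<^sub>R p = - (v t0 - v y - (t0 - y) *\<^sub>R p)"
            by (simp add: algebra_simps)
          then have "norm (v y - v t0 - (y - t0) *\<^sub>R p) = norm (v t0 - v y - (t0 - y) *\<^sub>R p)"
            by (simp only: norm_minus_cancel)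
          then show ?thesis using ap[of y t0] t0 y \<rho> False by (simp add: p_def)
        qed
      qed
    qed
  qed
  ultimately show ?thesis using that by blast
qed

text \<open>The case \<open>c = 0\<close> gives contraction and uniqueness, the case \<open>c > 0\<close> exponential convergence: the
  function \<open>(norm (x t))\<^sup>2 * exp (2 * c * t)\<close> does not increase.\<close>

lemma norm_decay:
  fixes x :: "real \<Rightarrow> 'a::real_inner"
  assumes b: "0 \<le> b"
    and der: "\<And>t. t \<in> {0..b} \<Longrightarrow> (x has_vector_derivative x' t) (at t within {0..b})"
    and neg: "\<And>t. 0 < t \<Longrightarrow> t < b \<Longrightarrow> x t \<bullet> x' t \<le> - c * (norm (x t))\<^sup>2"
  shows "norm (x b) \<le> norm (x 0) * exp (- c * b)"
proof -
  define \<phi> where "\<phi> t = (x t \<bullet> x t) * exp (2 * c * t)" for t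
  have cx: "continuous_on {0..b} x"
    by (rule continuous_on_vector_derivative[OF der])
  have "\<phi> b \<le> \<phi> 0"
  proof (rule DERIV_nonpos_imp_decreasing_open[OF b])
    show "continuous_on {0..b} \<phi>" unfolding \<phi>_def by (intro continuous_intros cx)
    fix t assume t: "0 < t" "t < b"
    then have "(x has_vector_derivative x' t) (at t)"
      using der[of t] at_within_Icc_at[of 0 t b] by simp
    then have xd: "(x has_derivative (\<lambda>s. s *\<^sub>R x' t)) (at t)" by (simp add: has_vector_derivative_def)
    have "((\<lambda>t. exp (2 * c * t)) has_derivative (\<lambda>s. s * (2 * c * exp (2 * c * t)))) (at t)"
      by (auto intro!: derivative_eq_intros)
    from has_derivative_mult[OF has_derivative_inner[OF xd xd] this]
    have "(\<phi> has_derivative (\<lambda>s. s * (2 * (x t \<bullet> x' t + c * (x t \<bullet> x t)) * exp (2 * c * t)))) (at t)"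
      unfolding \<phi>_def by (rule has_derivative_eq_rhs) (auto simp: inner_commute algebra_simps)
    then have "(\<phi> has_real_derivative (2 * (x t \<bullet> x' t + c * (x t \<bullet> x t)) * exp (2 * c * t))) (at t)"
      by (rule has_derivative_imp_has_field_derivative) (simp add: mult.assoc)
    moreover have "2 * (x t \<bullet> x' t + c * (x t \<bullet> x t)) * exp (2 * c * t) \<le> 0"
    proof -
      have "x t \<bullet> x' t + c * (x t \<bullet> x t) \<le> 0" using neg[OF t] by (simp add: power2_norm_eq_inner)
      then show ?thesis by (simp add: mult_nonpos_nonneg)
    qed
    ultimately show "\<exists>y. (\<phi> has_real_derivative y) (at t) \<and> y \<le> 0" by blast
  qed
  then have "(norm (x b))\<^sup>2 * (exp (c * b))\<^sup>2 \<le> (norm (x 0))\<^sup>2"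
    by (simp add: \<phi>_def power2_norm_eq_inner exp_double[symmetric] mult.assoc)
  then have "(norm (x b) * exp (c * b))\<^sup>2 \<le> (norm (x 0))\<^sup>2" by (simp add: power_mult_distrib)
  then have "norm (x b) * exp (c * b) \<le> norm (x 0)" by (rule power2_le_imp_le) simp
  then show ?thesis by (simp add: exp_minus field_simps)
qed

text \<open>By the mean value theorem the increment over an interval of length one is a value of the derivative;
  it tends to \<open>0\<close> because the function converges.\<close>

lemma derivative_limit_eq_0:
  fixes f :: "real \<Rightarrow> real"
  assumes der: "\<And>t. 0 \<le> t \<Longrightarrow> (f has_real_derivative g t) (at t within {0..})"
    and f: "(f \<longlongrightarrow> p) at_top" and g: "(g \<longlongrightarrow> L) at_top"
  shows "L = 0"
proof (rule ccontr)
  assume "L \<noteq> 0"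
  then have "\<forall>\<^sub>F t in at_top. dist (g t) L < \<bar>L\<bar> / 2" "\<forall>\<^sub>F t in at_top. dist (f t) p < \<bar>L\<bar> / 4"
    using tendstoD[OF g, of "\<bar>L\<bar> / 2"] tendstoD[OF f, of "\<bar>L\<bar> / 4"] by simp_all
  then have "\<forall>\<^sub>F t in at_top. dist (g t) L < \<bar>L\<bar> / 2 \<and> dist (f t) p < \<bar>L\<bar> / 4"
    by (rule eventually_conj)
  then obtain N where N: "\<And>t. N \<le> t \<Longrightarrow> dist (g t) L < \<bar>L\<bar> / 2 \<and> dist (f t) p < \<bar>L\<bar> / 4"
    unfolding eventually_at_top_linorder by blast
  define a where "a = max N 1"
  have a: "N \<le> a" "0 < a" by (simp_all add: a_def)
  have "\<exists>z. a < z \<and> z < a + 1 \<and> f (a + 1) - f a = (a + 1 - a) * g z"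
  proof (rule MVT2)
    fix t assume t: "a \<le> t" "t \<le> a + 1"
    then have "t \<in> interior {0..}" using a by simp
    then show "(f has_real_derivative g t) (at t)"
      using der[of t] t a at_within_interior[of t "{0..}"] by simp
  qed simp
  then obtain z where z: "a < z" "f (a + 1) - f a = g z" by auto
  have "dist (g z) L < \<bar>L\<bar> / 2" "dist (f a) p < \<bar>L\<bar> / 4" "dist (f (a + 1)) p < \<bar>L\<bar> / 4"
    using N[of z] N[of a] N[of "a + 1"] a z(1) by auto
  with z(2) show False unfolding dist_real_def by linarith
qed

lemma tendsto_exp_decay:
  assumes "0 < c"
  shows "((\<lambda>t::real. C * exp (- c * t)) \<longlongrightarrow> 0) at_top"
proof -
  have "filterlim (\<lambda>t::real. - c * t) at_bot at_top"
    by (rule filterlim_tendsto_neg_mult_at_bot[OF tendsto_const _ filterlim_ident]) (use assms in simp)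
  then have "((\<lambda>t. exp (- c * t)) \<longlongrightarrow> 0) at_top" by (rule filterlim_compose[OF exp_at_bot])
  then show ?thesis by (rule tendsto_mult_right_zero)
qed

lemma converges_exponentially_imp_tendsto:
  assumes "converges_exponentially r p"
  shows "(r \<longlongrightarrow> p) at_top"
proof -
  obtain C c where "0 < c" and le: "\<And>t. 0 \<le> t \<Longrightarrow> norm (r t - p) \<le> C * exp (- c * t)"
    using assms unfolding converges_exponentially_def by blast
  have "((\<lambda>t. C * exp (- c * t)) \<longlongrightarrow> 0) at_top" using \<open>0 < c\<close> by (rule tendsto_exp_decay)
  moreover have "\<forall>\<^sub>F t in at_top. norm (r t - p) \<le> C * exp (- c * t)"
    using eventually_ge_at_top[of 0] by eventually_elim (rule le)
  ultimately have "((\<lambda>t. r t - p) \<longlongrightarrow> 0) at_top" by (rule Lim_null_comparison[rotated])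
  then show ?thesis by (rule LIM_zero_cancel)
qed

section \<open>The angles of a face as functions of the dual radii\<close>

text \<open>A continuous function that decreased would cross a band of values that contains no element of \<open>V\<close>,
  and during a crossing the derivative is non-negative.\<close>

lemma nondecreasing_off_finite_values:
  fixes \<phi> :: "real \<Rightarrow> real"
  assumes "a \<le> b" and cont: "continuous_on {a..b} \<phi>" and fin: "finite V"
    and der: "\<And>s. a < s \<Longrightarrow> s < b \<Longrightarrow> \<phi> s \<in> V \<or> (\<exists>d\<ge>0. (\<phi> has_real_derivative d) (at s))"
  shows "\<phi> a \<le> \<phi> b"
proof (rule ccontr)
  assume "\<not> \<phi> a \<le> \<phi> b"
  then have lt: "\<phi> b < \<phi> a" by simp
  have "infinite ({\<phi> b<..<\<phi> a} - V)"
    using lt fin by (intro Diff_infinite_finite) (auto simp: infinite_Ioo)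
  then obtain y where "y \<in> {\<phi> b<..<\<phi> a} - V"
    using infinite_imp_nonempty by blast
  moreover have "open ({\<phi> b<..<\<phi> a} - V)" using fin by (intro open_Diff finite_imp_closed) auto
  ultimately obtain e where e: "0 < e" "cball y e \<subseteq> {\<phi> b<..<\<phi> a} - V"
    unfolding open_contains_cball by blast
  have gap: "\<phi> b < y - e" "y + e < \<phi> a"
    using subsetD[OF e(2), of "y - e"] subsetD[OF e(2), of "y + e"] e(1) by (auto simp: dist_real_def)
  have noV: "z \<notin> V" if "y - e \<le> z" "z \<le> y + e" for z
    using subsetD[OF e(2), of z] that by (auto simp: dist_real_def)
  \<comment> \<open>The last time at which the value is at least \<open>y + e\<close>, and the first later time at which
    it is at most \<open>y - e\<close>: in between the function avoids \<open>V\<close>.\<close>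
  define P where "P = {a..b} \<inter> \<phi> -` {y + e..}"
  have "closed P" unfolding P_def by (rule continuous_closed_preimage[OF cont]) auto
  then have "compact P" by (simp add: P_def compact_eq_bounded_closed bounded_Int)
  moreover have "a \<in> P" using \<open>a \<le> b\<close> gap by (auto simp: P_def)
  ultimately obtain p where p: "p \<in> P" "\<And>s. s \<in> P \<Longrightarrow> s \<le> p"
    using compact_attains_sup[of P] by blast
  have pab: "a \<le> p" "p \<le> b" "y + e \<le> \<phi> p" using p(1) by (auto simp: P_def)
  define Q where "Q = {p..b} \<inter> \<phi> -` {..y - e}"
  have "closed Q"
    unfolding Q_def using pab
    by (intro continuous_closed_preimage continuous_on_subset[OF cont]) auto
  then have "compact Q" by (simp add: Q_def compact_eq_bounded_closed bounded_Int)
  moreover have "b \<in> Q" using pab gap by (auto simp: Q_def)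
  ultimately obtain q where q: "q \<in> Q" "\<And>s. s \<in> Q \<Longrightarrow> q \<le> s"
    using compact_attains_inf[of Q] by blast
  have qpb: "p \<le> q" "q \<le> b" "\<phi> q \<le> y - e" using q(1) by (auto simp: Q_def)
  have "\<phi> p \<le> \<phi> q"
  proof (rule DERIV_nonneg_imp_increasing_open[OF qpb(1)])
    show "continuous_on {p..q} \<phi>" using pab qpb by (intro continuous_on_subset[OF cont]) auto
    fix s assume s: "p < s" "s < q"
    have "s \<notin> P" "s \<notin> Q" using p(2)[of s] q(2)[of s] s by auto
    then have "y - e \<le> \<phi> s" "\<phi> s \<le> y + e" using s pab qpb by (auto simp: P_def Q_def)
    then have "\<phi> s \<notin> V" by (rule noV)
    moreover have "a < s" "s < b" using s pab qpb by auto
    ultimately show "\<exists>d. (\<phi> has_real_derivative d) (at s) \<and> 0 \<le> d" using der by blast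
  qed
  with pab(3) qpb(3) e(1) show False by linarith
qed

definition edge_cosh :: "('v set \<Rightarrow> real) \<Rightarrow> real^'v \<Rightarrow> 'v \<Rightarrow> 'v::finite \<Rightarrow> real" where
  "edge_cosh I r i j = cosh (r $ i) * cosh (r $ j) + I {i, j} * sinh (r $ i) * sinh (r $ j)"

lemma edge_cosh_commute: "edge_cosh I r i j = edge_cosh I r j i"
  by (simp add: edge_cosh_def insert_commute mult_ac)

lemma cosh_real_gt_1: "0 < x \<Longrightarrow> 1 < cosh (x::real)"
  using cosh_real_nonneg_less_iff[of 0 x] by simp

lemma edge_cosh_gt_1:
  assumes "r \<in> pos_orthant" "0 \<le> I {i, j}"
  shows "1 < edge_cosh I r i j"
proof -
  have p: "0 < r $ i" "0 < r $ j" using assms by (simp_all add: pos_orthant_def)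
  have "1 * 1 < cosh (r $ i) * cosh (r $ j)"
    using cosh_real_gt_1[OF p(1)] cosh_real_gt_1[OF p(2)] by (intro mult_strict_mono) auto
  moreover have "0 \<le> I {i, j} * sinh (r $ i) * sinh (r $ j)"
    using p assms(2) by simp
  ultimately show ?thesis by (simp add: edge_cosh_def)
qed

lemma
  assumes "r \<in> pos_orthant" "0 \<le> I {i, j}"
  shows cosh_edge_length: "cosh (edge_length I r i j) = edge_cosh I r i j"
    and edge_length_pos: "0 < edge_length I r i j"
proof -
  have e: "edge_length I r i j = arcosh (edge_cosh I r i j)"
    by (simp add: edge_length_def edge_cosh_def)
  show c: "cosh (edge_length I r i j) = edge_cosh I r i j"
    using edge_cosh_gt_1[of r I i j] assms by (simp add: e)
  have "0 \<le> edge_length I r i j" using edge_cosh_gt_1[of r I i j] assms by (simp add: e)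
  moreover have "edge_length I r i j \<noteq> 0"
    using c edge_cosh_gt_1[of r I i j] assms by auto
  ultimately show "0 < edge_length I r i j" by simp
qed

text \<open>The geometric content of a non-negative inversive distance: these inequalities make all the
  combinations of weights in \<open>dual_weight_pos\<close> positive.\<close>

lemma cosh_lt_edge_cosh:
  assumes "r \<in> pos_orthant" "0 \<le> I {i, j}"
  shows "cosh (r $ j) < cosh (r $ i) * edge_cosh I r i j"
proof -
  have p: "0 < r $ i" "0 < r $ j" using assms by (simp_all add: pos_orthant_def)
  have "cosh (r $ j) * 1 < cosh (r $ j) * (cosh (r $ i) * cosh (r $ i))"
    using less_1_mult[OF cosh_real_gt_1[OF p(1)] cosh_real_gt_1[OF p(1)]]
    by (intro mult_strict_left_mono) auto
  also have "\<dots> \<le> cosh (r $ i) * edge_cosh I r i j"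
    using p assms(2) by (simp add: edge_cosh_def algebra_simps)
  finally show ?thesis by simp
qed

text \<open>Eliminating \<open>I\<^sub>i\<^sub>j * sinh r\<^sub>i * sinh r\<^sub>j\<close> in favour of the edge length, the derivative depends on the
  radii and on the edge lengths only, not on the inversive distances.\<close>

lemma has_derivative_edge_cosh:
  assumes "v \<in> pos_orthant"
  shows "((\<lambda>v. edge_cosh I (dual v) i j) has_derivative
    (\<lambda>h. - ((cosh (dual v $ i) * edge_cosh I (dual v) i j - cosh (dual v $ j)) * h $ i
           + (cosh (dual v $ j) * edge_cosh I (dual v) i j - cosh (dual v $ i)) * h $ j))) (at v)"
proof -
  note d = has_derivative_dual_component[OF assms]
  define ci cj si sj where "ci = cosh (dual v $ i)" "cj = cosh (dual v $ j)"
    "si = sinh (dual v $ i)" "sj = sinh (dual v $ j)"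
  note defs = ci_cj_si_sj_def
  have C: "((\<lambda>v. cosh (dual v $ a)) has_derivative (\<lambda>h. - sinh (dual v $ a) * h $ a * sinh (dual v $ a))) (at v)"
    and S: "((\<lambda>v. sinh (dual v $ a)) has_derivative (\<lambda>h. - sinh (dual v $ a) * h $ a * cosh (dual v $ a))) (at v)" for a
  proof -
    have "(cosh has_real_derivative sinh y) (at y)" "(sinh has_real_derivative cosh y) (at y)" for y :: real
      by (auto intro!: derivative_eq_intros)
    from DERIV_compose_FDERIV[where f = cosh, OF this(1) d[of a]]
      DERIV_compose_FDERIV[where f = sinh, OF this(2) d[of a]]
    show "((\<lambda>v. cosh (dual v $ a)) has_derivative (\<lambda>h. - sinh (dual v $ a) * h $ a * sinh (dual v $ a))) (at v)"
      "((\<lambda>v. sinh (dual v $ a)) has_derivative (\<lambda>h. - sinh (dual v $ a) * h $ a * cosh (dual v $ a))) (at v)" .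
  qed
  have "ci * ci = si * si + 1" "cj * cj = sj * sj + 1"
    using cosh_square_eq[of "dual v $ i"] cosh_square_eq[of "dual v $ j"]
    by (simp_all add: defs power2_eq_square)
  then have sq: "si * si = ci * ci - 1" "sj * sj = cj * cj - 1" by simp_all
  have "((\<lambda>v. edge_cosh I (dual v) i j) has_derivative (\<lambda>h. ci * (- sj * h $ j * sj) + (- si * h $ i * si) * cj
     + ((I {i, j} * si) * (- sj * h $ j * cj) + (I {i, j} * (- si * h $ i * ci)) * sj))) (at v)"
    unfolding edge_cosh_def defs
    by (intro has_derivative_add has_derivative_mult has_derivative_mult_right C S)
  moreover have "ci * (- sj * x * sj) + (- si * y * si) * cj
     + ((I {i, j} * si) * (- sj * x * cj) + (I {i, j} * (- si * y * ci)) * sj)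
     = - ((ci * edge_cosh I (dual v) i j - cj) * y + (cj * edge_cosh I (dual v) i j - ci) * x)" for x y
  proof -
    have "ci * (- sj * x * sj) + (- si * y * si) * cj
     + ((I {i, j} * si) * (- sj * x * cj) + (I {i, j} * (- si * y * ci)) * sj)
     = - (ci * (sj * sj) * x + cj * (si * si) * y + I {i, j} * si * sj * (cj * x + ci * y))"
      by (simp add: algebra_simps)
    then show ?thesis unfolding sq by (simp add: edge_cosh_def defs[symmetric] algebra_simps)
  qed
  ultimately show ?thesis by (simp add: defs)
qed

locale inversive_complex =
  fixes F :: "'v::finite set set" and I :: "'v set \<Rightarrow> real"
  assumes card_face: "f \<in> F \<Longrightarrow> card f = 3"
    and I_nonneg: "f \<in> F \<Longrightarrow> i \<in> f \<Longrightarrow> j \<in> f \<Longrightarrow> i \<noteq> j \<Longrightarrow> 0 \<le> I {i, j}"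
begin

abbreviation angle :: "real^'v \<Rightarrow> 'v set \<Rightarrow> 'v \<Rightarrow> real" where
  "angle r f i \<equiv> face_angle gen_angle I r i f"

lemma face_cases:
  assumes "f \<in> F"
  obtains i j k where "f = {i, j, k}" "i \<noteq> j" "j \<noteq> k" "i \<noteq> k"
    "0 \<le> I {i, j}" "0 \<le> I {j, k}" "0 \<le> I {i, k}"
proof -
  obtain i j k where "f = {i, j, k}" "i \<noteq> j" "j \<noteq> k" "i \<noteq> k"
    using card_face[OF assms] unfolding card_3_iff by blast
  note ijk = this
  show ?thesis
    by (rule that[OF ijk]) (use ijk in \<open>auto intro!: I_nonneg[OF assms]\<close>)
qed

lemma face_cases_at:
  assumes "f \<in> F" "i \<in> f"
  obtains j k where "f = {i, j, k}" "i \<noteq> j" "j \<noteq> k" "i \<noteq> k"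
    "0 \<le> I {i, j}" "0 \<le> I {j, k}" "0 \<le> I {i, k}"
proof -
  obtain a b c where f: "f = {a, b, c}" "a \<noteq> b" "b \<noteq> c" "a \<noteq> c"
    using face_cases[OF assms(1)] by metis
  have "\<exists>j k. f = {i, j, k} \<and> i \<noteq> j \<and> j \<noteq> k \<and> i \<noteq> k"
  proof -
    consider "i = a" | "i = b" | "i = c" using assms(2) f(1) by blast
    then show ?thesis
    proof cases
      case 1
      with f show ?thesis by blast
    next
      case 2
      moreover have "f = {b, a, c}" using f(1) by blast
      ultimately show ?thesis using f(2-4) by blast
    next
      case 3
      moreover have "f = {c, a, b}" using f(1) by blast
      ultimately show ?thesis using f(2-4) by blast
    qed
  qed
  then obtain j k where jk: "f = {i, j, k}" "i \<noteq> j" "j \<noteq> k" "i \<noteq> k" by blast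
  show ?thesis
    by (rule that[OF jk]) (use jk in \<open>auto intro!: I_nonneg[OF assms(1)]\<close>)
qed

lemma angle_eq:
  assumes r: "r \<in> pos_orthant" and d: "i \<noteq> j" "j \<noteq> k" "i \<noteq> k"
    and I: "0 \<le> I {i, j}" "0 \<le> I {j, k}" "0 \<le> I {i, k}"
  shows "angle r {i, j, k} i = cosine_angle (edge_cosh I r j k) (edge_cosh I r i k) (edge_cosh I r i j)"
proof -
  have "card {i, j, k} = 3" using d by simp
  then have "angle r {i, j, k} i = gen_angle (edge_length I r j k) (edge_length I r i k) (edge_length I r i j)"
    by (rule face_angle_gen_angle)
  then show ?thesis
    using r I by (simp add: gen_angle_eq_cosine_angle edge_length_pos cosh_edge_length)
qed

lemma angle_bounds:
  assumes "r \<in> pos_orthant" "f \<in> F" "i \<in> f"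
  shows "0 \<le> angle r f i" "angle r f i \<le> pi"
proof -
  obtain j k where "f = {i, j, k}" "i \<noteq> j" "j \<noteq> k" "i \<noteq> k"
    "0 \<le> I {i, j}" "0 \<le> I {j, k}" "0 \<le> I {i, k}" using face_cases_at[OF assms(2,3)] .
  then show "0 \<le> angle r f i" "angle r f i \<le> pi"
    using assms(1) by (simp_all add: angle_eq cosine_angle_bounds)
qed

lemma continuous_on_angle:
  assumes "f \<in> F" "i \<in> f"
  shows "continuous_on pos_orthant (\<lambda>r. angle r f i)"
proof -
  obtain j k where *: "f = {i, j, k}" "i \<noteq> j" "j \<noteq> k" "i \<noteq> k"
    "0 \<le> I {i, j}" "0 \<le> I {j, k}" "0 \<le> I {i, k}" using face_cases_at[OF assms] .
  have "continuous_on pos_orthant (\<lambda>r. edge_cosh I r a b)" for a b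
    unfolding edge_cosh_def by (intro continuous_intros)
  then have "continuous_on pos_orthant
      (\<lambda>r. cosine_angle (edge_cosh I r j k) (edge_cosh I r i k) (edge_cosh I r i j))"
    using * by (intro continuous_on_cosine_angle edge_cosh_gt_1) auto
  then show ?thesis
    by (rule continuous_on_eq) (use * in \<open>simp add: angle_eq\<close>)
qed

text \<open>The derivatives of the three angles of a face, together with the positivity that makes the
  angles strictly monotone to first order.\<close>

definition angle_derivative :: "'v set \<Rightarrow> real^'v \<Rightarrow> ('v \<Rightarrow> real^'v \<Rightarrow> real) \<Rightarrow> bool" where
  "angle_derivative f v D \<longleftrightarrow>
     (\<forall>i\<in>f. ((\<lambda>v. angle (dual v) f i) has_derivative D i) (at v)) \<and>
     (\<forall>h. (\<exists>i\<in>f. h $ i \<noteq> 0) \<longrightarrow> 0 < (\<Sum>i\<in>f. h $ i * D i h))"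

lemma angle_derivative_exists:
  assumes v: "v \<in> pos_orthant" and d: "i \<noteq> j" "j \<noteq> k" "i \<noteq> k"
    and I: "0 \<le> I {i, j}" "0 \<le> I {j, k}" "0 \<le> I {i, k}"
    and det: "0 < triangle_det (edge_cosh I (dual v) j k) (edge_cosh I (dual v) i k) (edge_cosh I (dual v) i j)"
  shows "\<exists>D. angle_derivative {i, j, k} v D"
proof -
  define r where "r = dual v"
  have r: "r \<in> pos_orthant" using v by (simp add: r_def dual_in_pos_orthant)
  define C1 C2 C3 where "C1 = edge_cosh I r j k" "C2 = edge_cosh I r i k" "C3 = edge_cosh I r i j"
  note Cs = C1_C2_C3_def
  define c1 c2 c3 where "c1 = cosh (r $ i)" "c2 = cosh (r $ j)" "c3 = cosh (r $ k)"
  note cs = c1_c2_c3_def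
  define d1 d2 d3 where "d1 h = - ((c2 * C1 - c3) * h $ j + (c3 * C1 - c2) * h $ k)"
    "d2 h = - ((c1 * C2 - c3) * h $ i + (c3 * C2 - c1) * h $ k)"
    "d3 h = - ((c1 * C3 - c2) * h $ i + (c2 * C3 - c1) * h $ j)" for h :: "real^'v"
  note ds = d1_d2_d3_def
  have C: "1 < C1" "1 < C2" "1 < C3" using r I by (simp_all add: Cs edge_cosh_gt_1)
  have dets: "triangle_det C2 C1 C3 = triangle_det C1 C2 C3" "triangle_det C3 C1 C2 = triangle_det C1 C2 C3"
    by (simp_all add: triangle_det_def)
  have det': "0 < triangle_det C1 C2 C3" using det by (simp add: Cs r_def)
  have I': "0 \<le> I {j, i}" "0 \<le> I {k, j}" "0 \<le> I {k, i}" using I by (simp_all add: insert_commute)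
  have com: "edge_cosh I r j i = C3" "edge_cosh I r k j = C1" "edge_cosh I r k i = C2"
    by (simp_all add: Cs edge_cosh_commute)
  have c: "c3 < c1 * C2" "c2 < c1 * C3" "c3 < c2 * C1" "c1 < c2 * C3" "c2 < c3 * C1" "c1 < c3 * C2"
    using cosh_lt_edge_cosh[OF r, of I i k] cosh_lt_edge_cosh[OF r, of I i j]
      cosh_lt_edge_cosh[OF r, of I j k] cosh_lt_edge_cosh[OF r, of I j i]
      cosh_lt_edge_cosh[OF r, of I k j] cosh_lt_edge_cosh[OF r, of I k i] I I'
    unfolding com by (simp_all add: Cs cs)
  have dC: "((\<lambda>v. edge_cosh I (dual v) j k) has_derivative d1) (at v)"
    "((\<lambda>v. edge_cosh I (dual v) i k) has_derivative d2) (at v)"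
    "((\<lambda>v. edge_cosh I (dual v) i j) has_derivative d3) (at v)"
    using has_derivative_edge_cosh[OF v, of I] unfolding ds cs Cs r_def by simp_all
  have vals: "edge_cosh I (dual v) j k = C1" "edge_cosh I (dual v) i k = C2" "edge_cosh I (dual v) i j = C3"
    by (simp_all add: Cs r_def)
  define A where "A = sqrt (triangle_det C1 C2 C3)"
  have A: "0 < A" using det' by (simp add: A_def)
  define D where "D a =
    (if a = i then (\<lambda>h. (d1 h - (C1 * C2 - C3) / (C2\<^sup>2 - 1) * d2 h - (C1 * C3 - C2) / (C3\<^sup>2 - 1) * d3 h) / A)
     else if a = j then (\<lambda>h. (d2 h - (C1 * C2 - C3) / (C1\<^sup>2 - 1) * d1 h - (C2 * C3 - C1) / (C3\<^sup>2 - 1) * d3 h) / A)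
     else (\<lambda>h. (d3 h - (C1 * C3 - C2) / (C1\<^sup>2 - 1) * d1 h - (C2 * C3 - C1) / (C2\<^sup>2 - 1) * d2 h) / A))" for a
  have tr: "((\<lambda>v. angle (dual v) {i, j, k} a) has_derivative D') (at v)"
    if "(g has_derivative D') (at v)" "\<And>v. v \<in> pos_orthant \<Longrightarrow> g v = angle (dual v) {i, j, k} a" for g a D'
    by (rule has_derivative_transform_within_open[OF that(1) open_pos_orthant v]) (rule that(2))
  have "((\<lambda>v. angle (dual v) {i, j, k} a) has_derivative D a) (at v)" if a: "a \<in> {i, j, k}" for a
  proof -
    consider "a = i" | "a = j" | "a = k" using a by blast
    then show ?thesis
    proof cases
      case 1
      have "((\<lambda>v. cosine_angle (edge_cosh I (dual v) j k) (edge_cosh I (dual v) i k) (edge_cosh I (dual v) i j))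
          has_derivative D i) (at v)"
        using has_derivative_cosine_angle[OF dC(1,2,3) vals C(2,3) det'] by (simp add: D_def A_def)
      then show ?thesis
        unfolding 1 by (rule tr) (use d I in \<open>simp add: angle_eq dual_in_pos_orthant\<close>)
    next
      case 2
      have "{i, j, k} = {j, i, k}" by auto
      have "((\<lambda>v. cosine_angle (edge_cosh I (dual v) i k) (edge_cosh I (dual v) j k) (edge_cosh I (dual v) i j))
          has_derivative D j) (at v)"
        using has_derivative_cosine_angle[OF dC(2,1,3) vals(2,1,3) C(1,3)] det' d
        by (simp add: D_def A_def dets mult.commute[of C2 C1])
      then show ?thesis
        unfolding 2 by (rule tr)
          (use d I I' in \<open>simp add: angle_eq dual_in_pos_orthant \<open>{i, j, k} = {j, i, k}\<close> edge_cosh_commute[of I _ j i]\<close>)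
    next
      case 3
      have "{i, j, k} = {k, i, j}" by auto
      have "((\<lambda>v. cosine_angle (edge_cosh I (dual v) i j) (edge_cosh I (dual v) j k) (edge_cosh I (dual v) i k))
          has_derivative D k) (at v)"
        using has_derivative_cosine_angle[OF dC(3,1,2) vals(3,1,2) C(1,2)] det' d
        by (simp add: D_def A_def dets mult.commute[of C3 C1] mult.commute[of C3 C2])
      then show ?thesis
        unfolding 3 by (rule tr)
          (use d I I' in \<open>simp add: angle_eq dual_in_pos_orthant \<open>{i, j, k} = {k, i, j}\<close>
             edge_cosh_commute[of I _ k i] edge_cosh_commute[of I _ k j]\<close>)
    qed
  qed
  moreover have "0 < (\<Sum>a\<in>{i, j, k}. h $ a * D a h)" if "\<exists>a\<in>{i, j, k}. h $ a \<noteq> 0" for h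
  proof -
    have "0 < h $ i * (A * D i h) + h $ j * (A * D j h) + h $ k * (A * D k h)"
      using dual_angle_form_pos[OF C det' c, of "h $ i" "h $ j" "h $ k"] that A d
      by (simp add: D_def ds)
    also have "\<dots> = A * (\<Sum>a\<in>{i, j, k}. h $ a * D a h)"
      using d by (simp add: algebra_simps)
    finally show ?thesis using A by (simp add: zero_less_mult_iff)
  qed
  ultimately show ?thesis unfolding angle_derivative_def by blast
qed

text \<open>The triangle determinant decides: if it is positive the angles are smooth at \<open>v\<close>, otherwise the
  triangle is degenerate.\<close>

lemma angle_derivative_dichotomy:
  assumes v: "v \<in> pos_orthant" and f: "f \<in> F"
  shows "(\<exists>D. angle_derivative f v D) \<or> (\<forall>i\<in>f. angle (dual v) f i \<in> {0, pi})"
proof -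
  obtain i j k where *: "f = {i, j, k}" "i \<noteq> j" "j \<noteq> k" "i \<noteq> k"
    "0 \<le> I {i, j}" "0 \<le> I {j, k}" "0 \<le> I {i, k}" using face_cases[OF f] .
  define r where "r = dual v"
  have r: "r \<in> pos_orthant" using v by (simp add: r_def dual_in_pos_orthant)
  show ?thesis
  proof (cases "0 < triangle_det (edge_cosh I r j k) (edge_cosh I r i k) (edge_cosh I r i j)")
    case True
    then show ?thesis using angle_derivative_exists[OF v *(2-7)] *(1) by (simp add: r_def)
  next
    case False
    have "angle r f a \<in> {0, pi}" if a: "a \<in> f" for a
    proof -
      obtain b c where bc: "f = {a, b, c}" "a \<noteq> b" "b \<noteq> c" "a \<noteq> c"
        "0 \<le> I {a, b}" "0 \<le> I {b, c}" "0 \<le> I {a, c}" using face_cases_at[OF f a] .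
      have "a \<in> {i, j, k}" "b \<in> {i, j, k}" "c \<in> {i, j, k}" using bc(1) *(1) by auto
      then have "triangle_det (edge_cosh I r b c) (edge_cosh I r a c) (edge_cosh I r a b)
          = triangle_det (edge_cosh I r j k) (edge_cosh I r i k) (edge_cosh I r i j)"
        using bc(2-4) *(2-4)
        by (elim insertE emptyE) (simp_all add: triangle_det_def edge_cosh_commute[of I r k i]
            edge_cosh_commute[of I r k j] edge_cosh_commute[of I r j i])
      then have "triangle_det (edge_cosh I r b c) (edge_cosh I r a c) (edge_cosh I r a b) \<le> 0"
        using False by simp
      then have "cosine_angle (edge_cosh I r b c) (edge_cosh I r a c) (edge_cosh I r a b) \<in> {0, pi}"
        using r bc by (intro cosine_angle_degenerate edge_cosh_gt_1) auto
      then show ?thesis unfolding bc(1) using r bc(2-7) by (simp add: angle_eq)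
    qed
    then show ?thesis by (simp add: r_def)
  qed
qed

lemma angle_derivative_in_Omega:
  assumes v: "v \<in> pos_orthant" and f: "f \<in> F" and O: "dual v \<in> Omega F I"
  shows "\<exists>D. angle_derivative f v D"
proof -
  obtain i j k where *: "f = {i, j, k}" "i \<noteq> j" "j \<noteq> k" "i \<noteq> k"
    "0 \<le> I {i, j}" "0 \<le> I {j, k}" "0 \<le> I {i, k}" using face_cases[OF f] .
  have r: "dual v \<in> pos_orthant" using v by (simp add: dual_in_pos_orthant)
  have "strict_triangle (edge_length I (dual v) i j) (edge_length I (dual v) j k) (edge_length I (dual v) i k)"
    using O f *(1) unfolding Omega_def by blast
  then have "0 < triangle_det (edge_cosh I (dual v) i j) (edge_cosh I (dual v) j k) (edge_cosh I (dual v) i k)"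
    using strict_triangle_imp_triangle_det_pos r * by (metis cosh_edge_length)
  then have "0 < triangle_det (edge_cosh I (dual v) j k) (edge_cosh I (dual v) i k) (edge_cosh I (dual v) i j)"
    by (simp add: triangle_det_def algebra_simps)
  then show ?thesis using angle_derivative_exists[OF v *(2-7)] *(1) by simp
qed

text \<open>Along the segment from \<open>w\<close> to \<open>v\<close>, the pairing of the angles with \<open>v - w\<close> has a non-negative
  derivative where the triangle is non-degenerate; elsewhere it takes one of the finitely many values
  that arise from angles \<open>0\<close> and \<open>pi\<close>.\<close>

lemma angle_monotone:
  assumes v: "v \<in> pos_orthant" and w: "w \<in> pos_orthant" and f: "f \<in> F"
  shows "0 \<le> (\<Sum>i\<in>f. (v $ i - w $ i) * (angle (dual v) f i - angle (dual w) f i))"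
proof -
  define x where "x = v - w"
  define \<gamma> where "\<gamma> s = w + s *\<^sub>R x" for s
  have \<gamma>: "\<gamma> s \<in> pos_orthant" if "0 \<le> s" "s \<le> 1" for s
  proof -
    have "\<gamma> s = (1 - s) *\<^sub>R w + s *\<^sub>R v" by (simp add: \<gamma>_def x_def algebra_simps)
    then show ?thesis using convexD[OF convex_pos_orthant w v, of "1 - s" s] that by simp
  qed
  define \<phi> where "\<phi> s = (\<Sum>i\<in>f. x $ i * angle (dual (\<gamma> s)) f i)" for s
  define V where "V = (\<lambda>g. \<Sum>i\<in>f. x $ i * g i) ` (PiE f (\<lambda>_. {0, pi}))"
  have "\<phi> 0 \<le> \<phi> 1"
  proof (rule nondecreasing_off_finite_values[where \<phi> = \<phi> and a = 0 and b = 1 and V = V])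
    show "finite V" unfolding V_def by (intro finite_imageI finite_PiE) auto
    have "continuous_on {0..1} (\<lambda>s. angle (dual (\<gamma> s)) f i)" if "i \<in> f" for i
    proof (rule continuous_on_compose2[OF continuous_on_angle[OF f that]])
      show "continuous_on {0..1} (\<lambda>s. dual (\<gamma> s))"
        by (rule continuous_on_compose2[OF continuous_on_dual])
          (auto simp: \<gamma> intro!: continuous_intros, auto simp: \<gamma>_def intro!: continuous_intros)
      show "(\<lambda>s. dual (\<gamma> s)) ` {0..1} \<subseteq> pos_orthant" by (auto simp: \<gamma> dual_in_pos_orthant)
    qed
    then show "continuous_on {0..1} \<phi>" unfolding \<phi>_def by (intro continuous_intros) auto
    fix s :: real assume s: "0 < s" "s < 1"
    then have gs: "\<gamma> s \<in> pos_orthant" using \<gamma> by simp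
    show "\<phi> s \<in> V \<or> (\<exists>d\<ge>0. (\<phi> has_real_derivative d) (at s))"
      using angle_derivative_dichotomy[OF gs f]
    proof
      assume "\<forall>i\<in>f. angle (dual (\<gamma> s)) f i \<in> {0, pi}"
      then have "restrict (angle (dual (\<gamma> s)) f) f \<in> PiE f (\<lambda>_. {0, pi})" by auto
      moreover have "\<phi> s = (\<Sum>i\<in>f. x $ i * restrict (angle (dual (\<gamma> s)) f) f i)"
        by (simp add: \<phi>_def)
      ultimately show ?thesis unfolding V_def by blast
    next
      assume "\<exists>D. angle_derivative f (\<gamma> s) D"
      then obtain D where D: "\<And>i. i \<in> f \<Longrightarrow> ((\<lambda>v. angle (dual v) f i) has_derivative D i) (at (\<gamma> s))"
        "\<And>h. \<exists>i\<in>f. h $ i \<noteq> 0 \<Longrightarrow> 0 < (\<Sum>i\<in>f. h $ i * D i h)"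
        unfolding angle_derivative_def by blast
      have \<gamma>': "(\<gamma> has_derivative (\<lambda>t. t *\<^sub>R x)) (at s)"
        unfolding \<gamma>_def by (auto intro!: derivative_eq_intros)
      have "(\<phi> has_derivative (\<lambda>t. \<Sum>i\<in>f. x $ i * D i (t *\<^sub>R x))) (at s)"
        unfolding \<phi>_def
        by (intro has_derivative_sum has_derivative_mult_right has_derivative_compose[OF \<gamma>'] D)
      moreover have "(\<Sum>i\<in>f. x $ i * D i (t *\<^sub>R x)) = (\<Sum>i\<in>f. x $ i * D i x) * t" for t
      proof -
        have "D i (t *\<^sub>R x) = t * D i x" if "i \<in> f" for i
          using linear_scale[OF has_derivative_linear[OF D(1)[OF that]]] by simp
        then show ?thesis by (simp add: sum_distrib_left mult_ac)
      qed
      ultimately have "(\<phi> has_real_derivative (\<Sum>i\<in>f. x $ i * D i x)) (at s)"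
        by (simp add: has_field_derivative_def)
      moreover have "0 \<le> (\<Sum>i\<in>f. x $ i * D i x)"
      proof (cases "\<exists>i\<in>f. x $ i \<noteq> 0")
        case True
        then show ?thesis using D(2) by (simp add: less_imp_le)
      next
        case False
        then show ?thesis by simp
      qed
      ultimately show ?thesis by blast
    qed
  qed simp
  also have "\<phi> 1 = (\<Sum>i\<in>f. x $ i * angle (dual v) f i)" by (simp add: \<phi>_def \<gamma>_def x_def)
  finally show ?thesis
    by (simp add: \<phi>_def \<gamma>_def x_def algebra_simps sum_subtractf sum.distrib)
qed

section \<open>The curvature as a vector field in the dual radii\<close>

definition dual_field :: "real^'v \<Rightarrow> real^'v" where
  "dual_field v = (\<chi> i. ext_curvature F I (dual v) i)"

lemma dual_field_component:
  "dual_field v $ i = 2 * pi - (\<Sum>f\<in>{f \<in> F. i \<in> f}. angle (dual v) f i)"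
  by (simp add: dual_field_def ext_curvature_def)

lemma continuous_on_ext_curvature: "continuous_on pos_orthant (\<lambda>r. ext_curvature F I r i)"
  unfolding ext_curvature_def by (intro continuous_intros continuous_on_angle) auto

lemma continuous_on_dual_field: "continuous_on pos_orthant dual_field"
  unfolding dual_field_def
  by (intro continuous_on_vec_lambda continuous_on_compose2[OF continuous_on_ext_curvature continuous_on_dual])
    (auto simp: dual_in_pos_orthant)

lemma sum_vertices_faces:
  "(\<Sum>i\<in>UNIV. \<Sum>f\<in>{f \<in> F. i \<in> f}. g i f) = (\<Sum>f\<in>F. \<Sum>i\<in>f. g i f)"
  using sum.swap_restrict[of "UNIV :: 'v set" F g "\<lambda>i f. i \<in> f"] by simp

lemma inner_dual_field_diff:
  "x \<bullet> (dual_field v - dual_field w) = - (\<Sum>f\<in>F. \<Sum>i\<in>f. x $ i * (angle (dual v) f i - angle (dual w) f i))"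
proof -
  have "x \<bullet> (dual_field v - dual_field w)
      = (\<Sum>i\<in>UNIV. \<Sum>f\<in>{f \<in> F. i \<in> f}. - (x $ i * (angle (dual v) f i - angle (dual w) f i)))"
    unfolding inner_vec_def
    by (intro sum.cong refl)
      (simp add: dual_field_component sum_distrib_left[symmetric] sum_negf sum_subtractf algebra_simps)
  also have "\<dots> = (\<Sum>f\<in>F. \<Sum>i\<in>f. - (x $ i * (angle (dual v) f i - angle (dual w) f i)))"
    by (rule sum_vertices_faces)
  finally show ?thesis by (simp add: sum_negf)
qed

lemma dual_field_dissipative:
  assumes "v \<in> pos_orthant" "w \<in> pos_orthant"
  shows "(v - w) \<bullet> (dual_field v - dual_field w) \<le> 0"
  unfolding inner_dual_field_diff using angle_monotone[OF assms] by (simp add: sum_nonneg)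

text \<open>The derivative of the field at \<open>w\<close> is negative definite; its largest value on the unit sphere
  dominates the remainder of the linear approximation. Every vertex must lie in a face, for otherwise
  its angle sum would be constant.\<close>

lemma dual_field_coercive_near:
  assumes w: "w \<in> pos_orthant" and O: "dual w \<in> Omega F I" and cover: "\<And>i. \<exists>f\<in>F. i \<in> f"
  shows "\<exists>c>0. \<exists>e>0. \<forall>v. norm (v - w) < e \<longrightarrow> (v - w) \<bullet> (dual_field v - dual_field w) \<le> - c * (norm (v - w))\<^sup>2"
proof -
  have "\<forall>f\<in>F. \<exists>D. angle_derivative f w D" using angle_derivative_in_Omega[OF w _ O] by blast
  then obtain D where "\<forall>f\<in>F. angle_derivative f w (D f)" using bchoice by metis
  then have ad: "angle_derivative f w (D f)" if "f \<in> F" for f using that by blast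
  have D: "((\<lambda>v. angle (dual v) f i) has_derivative D f i) (at w)" if "f \<in> F" "i \<in> f" for f i
    using ad that unfolding angle_derivative_def by blast
  have Dpos: "0 < (\<Sum>i\<in>f. h $ i * D f i h)" if "f \<in> F" "\<exists>i\<in>f. h $ i \<noteq> 0" for f h
    using ad that unfolding angle_derivative_def by blast
  define T where "T h = (\<chi> i. - (\<Sum>f\<in>{f \<in> F. i \<in> f}. D f i h))" for h
  have T: "(dual_field has_derivative T) (at w)"
  proof (rule has_derivative_vecI)
    fix i
    have "((\<lambda>v. 2 * pi - (\<Sum>f\<in>{f \<in> F. i \<in> f}. angle (dual v) f i)) has_derivative
        (\<lambda>h. 0 - (\<Sum>f\<in>{f \<in> F. i \<in> f}. D f i h))) (at w)"
      by (intro has_derivative_diff has_derivative_const has_derivative_sum D) auto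
    then show "((\<lambda>v. dual_field v $ i) has_derivative (\<lambda>h. T h $ i)) (at w)"
      by (simp add: dual_field_component T_def)
  qed
  have "h \<bullet> T h = (\<Sum>i\<in>UNIV. \<Sum>f\<in>{f \<in> F. i \<in> f}. - (h $ i * D f i h))" for h
    unfolding inner_vec_def by (intro sum.cong refl) (simp add: T_def sum_negf sum_distrib_left)
  then have inner_T: "h \<bullet> T h = - (\<Sum>f\<in>F. \<Sum>i\<in>f. h $ i * D f i h)" for h
    by (simp only: sum_vertices_faces sum_negf)
  have neg: "h \<bullet> T h < 0" if "h \<noteq> 0" for h
  proof -
    have nn: "0 \<le> (\<Sum>i\<in>f. h $ i * D f i h)" if "f \<in> F" for f
      by (cases "\<exists>i\<in>f. h $ i \<noteq> 0") (auto intro: less_imp_le[OF Dpos[OF that]])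
    obtain i where i: "h $ i \<noteq> 0" using \<open>h \<noteq> 0\<close> by (auto simp: vec_eq_iff)
    obtain f where f: "f \<in> F" "i \<in> f" using cover by blast
    have "0 < (\<Sum>f\<in>F. \<Sum>i\<in>f. h $ i * D f i h)"
      using f i nn Dpos[OF f(1)] by (intro sum_pos2[of F f]) auto
    then show ?thesis by (simp add: inner_T)
  qed
  have lin: "bounded_linear T" using T by (rule has_derivative_bounded_linear)
  have "continuous_on (sphere 0 1) (\<lambda>h. h \<bullet> T h)"
    by (intro continuous_intros linear_continuous_on lin)
  moreover have "sphere (0 :: real^'v) 1 \<noteq> {}" by (simp add: sphere_eq_empty)
  ultimately obtain h0 where h0: "norm h0 = 1" "\<And>h. norm h = 1 \<Longrightarrow> h \<bullet> T h \<le> h0 \<bullet> T h0"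
    using continuous_attains_sup[of "sphere (0 :: real^'v) 1" "\<lambda>h. h \<bullet> T h"] by (auto simp: dist_norm)
  define c where "c = - (h0 \<bullet> T h0) / 2"
  have "h0 \<noteq> 0" using h0(1) by (metis norm_zero zero_neq_one)
  then have c: "0 < c" using neg[of h0] by (simp add: c_def)
  have Tc: "h \<bullet> T h \<le> - 2 * c * (norm h)\<^sup>2" for h
  proof (cases "h = 0")
    case True
    then show ?thesis using lin by (simp add: linear_simps)
  next
    case False
    define u where "u = (1 / norm h) *\<^sub>R h"
    have u: "norm u = 1" "h = norm h *\<^sub>R u" using False by (simp_all add: u_def)
    have "h \<bullet> T h = (norm h)\<^sup>2 * (u \<bullet> T u)"
      by (subst (1 2) u(2)) (simp add: linear_scale[OF bounded_linear.linear[OF lin]] power2_eq_square)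
    also have "\<dots> \<le> (norm h)\<^sup>2 * (- 2 * c)"
      using h0(2)[OF u(1)] by (intro mult_left_mono) (auto simp: c_def)
    finally show ?thesis by (simp add: mult_ac)
  qed
  obtain e where e: "e > 0" "\<And>v. norm (v - w) < e \<Longrightarrow>
      norm (dual_field v - dual_field w - T (v - w)) \<le> c * norm (v - w)"
    using T c unfolding has_derivative_at_alt by blast
  have "(v - w) \<bullet> (dual_field v - dual_field w) \<le> - c * (norm (v - w))\<^sup>2" if "norm (v - w) < e" for v
  proof -
    have "(v - w) \<bullet> (dual_field v - dual_field w - T (v - w)) \<le> norm (v - w) * (c * norm (v - w))"
      using norm_cauchy_schwarz e(2)[OF that] by (meson mult_left_mono norm_ge_zero order_trans)
    moreover have "(v - w) \<bullet> T (v - w) \<le> - 2 * c * (norm (v - w))\<^sup>2" by (rule Tc)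
    ultimately show ?thesis by (simp add: inner_diff_right power2_eq_square algebra_simps)
  qed
  with c e(1) show ?thesis by blast
qed

text \<open>On the segment from \<open>w\<close> to \<open>v\<close>, monotonicity bounds \<open>(v - w) \<bullet> K v\<close> by its value at a point near
  \<open>w\<close>, where the local estimate applies. The vertices are covered by faces because a vertex in no face has
  curvature \<open>2 * pi\<close>.\<close>

lemma dual_field_coercive:
  assumes w: "w \<in> pos_orthant" and O: "dual w \<in> Omega F I" and zero: "dual_field w = 0"
  shows "\<exists>c>0. \<forall>v\<in>pos_orthant. norm (v - w) \<le> R \<longrightarrow> (v - w) \<bullet> dual_field v \<le> - c * (norm (v - w))\<^sup>2"
proof -
  have cover: "\<exists>f\<in>F. i \<in> f" for i
  proof (rule ccontr)
    assume "\<not> ?thesis"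
    then have "{f \<in> F. i \<in> f} = {}" by blast
    then have "dual_field w $ i = 2 * pi" unfolding dual_field_component by (simp only: sum.empty)
    then show False using zero by simp
  qed
  obtain c e where c: "0 < c" and e: "0 < e"
    and near: "\<And>v. norm (v - w) < e \<Longrightarrow> (v - w) \<bullet> dual_field v \<le> - c * (norm (v - w))\<^sup>2"
    using dual_field_coercive_near[OF w O cover] by (auto simp: zero)
  \<comment> \<open>Far from \<open>w\<close> the estimate is linear in the distance, hence quadratic up to the factor \<open>R\<close>; the
    maximum with \<open>e\<close> keeps the constant positive for every \<open>R\<close>.\<close>
  define c' where "c' = min c (c * (e / 2) / max R e)"
  have c': "0 < c'" using c e by (simp add: c'_def)
  have "(v - w) \<bullet> dual_field v \<le> - c' * (norm (v - w))\<^sup>2"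
    if v: "v \<in> pos_orthant" and R: "norm (v - w) \<le> R" for v
  proof (cases "norm (v - w) < e")
    case True
    have "- c * (norm (v - w))\<^sup>2 \<le> - c' * (norm (v - w))\<^sup>2"
      by (intro mult_right_mono) (auto simp: c'_def)
    with near[OF True] show ?thesis by linarith
  next
    case False
    define d s y where "d = norm (v - w)" "s = e / 2 / d" "y = w + s *\<^sub>R (v - w)"
    note defs = d_s_y_def
    have d: "e \<le> d" "0 < d" using False e by (auto simp: defs(1))
    have s: "0 < s" "s < 1" using d e by (auto simp: defs(2) field_simps)
    have "y = (1 - s) *\<^sub>R w + s *\<^sub>R v" by (simp add: defs(3) algebra_simps)
    then have y: "y \<in> pos_orthant" using convexD[OF convex_pos_orthant w v, of "1 - s" s] s by simp
    have yw: "y - w = s *\<^sub>R (v - w)" and vy: "v - y = (1 - s) *\<^sub>R (v - w)"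
      by (simp_all add: defs(3) algebra_simps)
    have nyw: "norm (y - w) = e / 2" using s d by (simp add: yw defs(1)[symmetric]) (simp add: defs(2))
    have "(1 - s) * ((v - w) \<bullet> (dual_field v - dual_field y)) \<le> 0"
      using dual_field_dissipative[OF v y] by (simp add: vy)
    then have "(v - w) \<bullet> (dual_field v - dual_field y) \<le> 0" using s by (simp add: mult_le_0_iff)
    then have mono: "(v - w) \<bullet> dual_field v \<le> (v - w) \<bullet> dual_field y" by (simp add: inner_diff_right)
    have "(y - w) \<bullet> dual_field y \<le> - c * (e / 2)\<^sup>2"
      using near[of y] e unfolding nyw by simp
    then have "s * ((v - w) \<bullet> dual_field y) \<le> - c * (e / 2)\<^sup>2"
      unfolding yw by simp
    also have "\<dots> = s * (- c * (e / 2) * d)"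
      using d by (simp add: defs(2) power2_eq_square)
    finally have "(v - w) \<bullet> dual_field y \<le> - c * (e / 2) * d"
      using s(1) by (simp only: mult_le_cancel_left_pos)
    also have "\<dots> \<le> - c' * d\<^sup>2"
    proof -
      have "c' * d \<le> c * (e / 2) / max R e * max R e"
        using R d c e by (intro mult_mono) (auto simp: c'_def defs(1))
      also have "\<dots> = c * (e / 2)" using e by simp
      finally have "c' * d * d \<le> c * (e / 2) * d" using d by (intro mult_right_mono) auto
      then show ?thesis by (simp add: power2_eq_square mult.assoc)
    qed
    finally show ?thesis using mono by (simp add: defs(1))
  qed
  with c' show ?thesis by blast
qed

lemma norm_dual_field_le:
  assumes "v \<in> pos_orthant"
  shows "norm (dual_field v) \<le> CARD('v) * (2 * pi + card F * pi)"
proof -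
  have "\<bar>dual_field v $ i\<bar> \<le> 2 * pi + card F * pi" for i
  proof -
    have b: "0 \<le> angle (dual v) f i" "angle (dual v) f i \<le> pi" if "f \<in> {f \<in> F. i \<in> f}" for f
      using angle_bounds[OF dual_in_pos_orthant[OF assms]] that by auto
    have "0 \<le> (\<Sum>f\<in>{f \<in> F. i \<in> f}. angle (dual v) f i)" using b by (intro sum_nonneg)
    moreover have "(\<Sum>f\<in>{f \<in> F. i \<in> f}. angle (dual v) f i) \<le> card {f \<in> F. i \<in> f} * pi"
      using b by (intro sum_bounded_above)
    moreover have "card {f \<in> F. i \<in> f} * pi \<le> card F * pi"
      by (intro mult_right_mono) (auto intro: card_mono)
    moreover have "0 \<le> card F * pi" by simp
    ultimately show ?thesis
      unfolding dual_field_component abs_le_iff using pi_gt_zero by linarith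
  qed
  then have "(\<Sum>i\<in>UNIV. \<bar>dual_field v $ i\<bar>) \<le> CARD('v) * (2 * pi + card F * pi)"
    by (intro sum_bounded_above)
  with norm_le_l1_cart show ?thesis by (rule order_trans)
qed

text \<open>With \<open>C1\<close> the opposite edge and \<open>C2\<close>, \<open>C3\<close> the adjacent ones, \<open>C1\<close> is at most
  \<open>(1 + I) * cosh r\<^sub>j * cosh r\<^sub>k\<close>, while the product of the two adjacent hyperbolic sines is at least
  \<open>(sinh r\<^sub>i)\<^sup>2 * cosh r\<^sub>j * cosh r\<^sub>k\<close>. So the cosine of the angle tends to \<open>1\<close> uniformly in the other two
  radii as \<open>r\<^sub>i\<close> grows.\<close>

lemma angle_le_of_large_radius:
  assumes r: "r \<in> pos_orthant" and f: "f \<in> F" "i \<in> f" and \<epsilon>: "0 \<le> \<epsilon>" "\<epsilon> \<le> pi"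
    and large: "1 + (\<Sum>e\<in>UNIV. \<bar>I e\<bar>) \<le> (1 - cos \<epsilon>) * (sinh (r $ i))\<^sup>2"
  shows "angle r f i \<le> \<epsilon>"
proof -
  obtain j k where jk: "f = {i, j, k}" "i \<noteq> j" "j \<noteq> k" "i \<noteq> k"
    "0 \<le> I {i, j}" "0 \<le> I {j, k}" "0 \<le> I {i, k}" using face_cases_at[OF f] .
  define s where "s = sinh (r $ i)"
  have s: "0 < s" using r by (simp add: s_def pos_orthant_def)
  have rp: "0 < r $ i" "0 < r $ j" "0 < r $ k" using r by (auto simp: pos_orthant_def)
  define C1 C2 C3 where "C1 = edge_cosh I r j k" "C2 = edge_cosh I r i k" "C3 = edge_cosh I r i j"
  note Cs = C1_C2_C3_def
  have C: "1 < C1" "1 < C2" "1 < C3" using r jk(5-7) by (simp_all add: Cs edge_cosh_gt_1)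
  have S: "s * cosh (r $ a) \<le> sqrt ((edge_cosh I r i a)\<^sup>2 - 1)" if "0 \<le> I {i, a}" for a
  proof (rule real_le_rsqrt)
    have ra: "0 < r $ a" using r by (simp add: pos_orthant_def)
    have "cosh (r $ i) * cosh (r $ a) \<le> edge_cosh I r i a"
      using that rp ra by (simp add: edge_cosh_def)
    then have "(cosh (r $ i) * cosh (r $ a))\<^sup>2 \<le> (edge_cosh I r i a)\<^sup>2"
      by (intro power_mono) auto
    moreover have "(cosh (r $ i) * cosh (r $ a))\<^sup>2 = (s * cosh (r $ a))\<^sup>2 + (cosh (r $ a))\<^sup>2"
      by (simp add: power_mult_distrib cosh_square_eq s_def algebra_simps)
    moreover have "1 \<le> (cosh (r $ a))\<^sup>2" using cosh_real_ge_1[of "r $ a"] by simp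
    ultimately show "(s * cosh (r $ a))\<^sup>2 \<le> (edge_cosh I r i a)\<^sup>2 - 1" by linarith
  qed
  define S2 S3 where "S2 = sqrt (C2\<^sup>2 - 1)" "S3 = sqrt (C3\<^sup>2 - 1)"
  define c where "c = cosh (r $ j) * cosh (r $ k)"
  have c: "0 < c" by (simp add: c_def)
  have "1 \<le> C2\<^sup>2" "1 \<le> C3\<^sup>2" using C by simp_all
  then have "(s * cosh (r $ k)) * (s * cosh (r $ j)) \<le> S2 * S3"
    unfolding S2_S3_def Cs using S[OF jk(7)] S[OF jk(5)] s by (intro mult_mono) auto
  then have SS: "s\<^sup>2 * c \<le> S2 * S3" by (simp add: c_def power2_eq_square mult_ac)
  have S_pos: "0 < S2 * S3" using SS s c by (smt (verit) mult_pos_pos zero_less_power)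
  have "C1 \<le> (1 + I {j, k}) * c"
  proof -
    have "sinh (r $ j) * sinh (r $ k) \<le> c"
      unfolding c_def using rp sinh_le_cosh_real by (intro mult_mono) auto
    then have "I {j, k} * (sinh (r $ j) * sinh (r $ k)) \<le> I {j, k} * c"
      using jk(6) by (intro mult_left_mono)
    then show ?thesis by (simp add: Cs edge_cosh_def c_def algebra_simps)
  qed
  also have "\<dots> \<le> ((1 - cos \<epsilon>) * s\<^sup>2) * c"
  proof -
    have "I {j, k} \<le> (\<Sum>e\<in>UNIV. \<bar>I e\<bar>)"
      using member_le_sum[of "{j, k}" UNIV "\<lambda>e. \<bar>I e\<bar>"] by simp
    then show ?thesis using large c by (intro mult_right_mono) (auto simp: s_def)
  qed
  also have "\<dots> \<le> (1 - cos \<epsilon>) * (S2 * S3)"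
    using mult_left_mono[OF SS, of "1 - cos \<epsilon>"] by (simp add: mult.assoc)
  finally have C1: "C1 \<le> (1 - cos \<epsilon>) * (S2 * S3)" .
  have "S2 * S3 \<le> C2 * C3"
    unfolding S2_S3_def using C by (intro mult_mono) (auto intro!: real_le_lsqrt)
  then have "cos \<epsilon> * (S2 * S3) \<le> C2 * C3 - C1" using C1 by (simp add: algebra_simps)
  then have q: "cos \<epsilon> \<le> (C2 * C3 - C1) / (S2 * S3)" using S_pos by (simp add: pos_le_divide_eq)
  have "angle r f i = arccos (max (- 1) (min 1 ((C2 * C3 - C1) / (S2 * S3))))"
    unfolding jk(1) using r jk(2-7) by (simp add: angle_eq cosine_angle_def Cs S2_S3_def)
  also have "\<dots> \<le> arccos (cos \<epsilon>)"
    using q cos_le_one[of \<epsilon>] cos_ge_minus_one[of \<epsilon>]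
    by (intro arccos_le_arccos) (simp_all add: le_max_iff_disj)
  also have "\<dots> = \<epsilon>" using \<epsilon> by (rule arccos_cos)
  finally show ?thesis .
qed

text \<open>A small dual radius is a large radius, for which the angles at the vertex sum up to at most \<open>pi\<close>.\<close>

lemma dual_field_barrier:
  obtains \<delta> where "0 < \<delta>" "\<And>v i. v \<in> pos_orthant \<Longrightarrow> v $ i < \<delta> \<Longrightarrow> 0 < dual_field v $ i"
proof
  \<comment> \<open>At most \<open>card F\<close> angles of size at most \<open>\<epsilon>\<close> meet at a vertex.\<close>
  define \<epsilon> where "\<epsilon> = pi / (card F + 1)"
  have \<epsilon>: "0 < \<epsilon>" "\<epsilon> \<le> pi" by (simp_all add: \<epsilon>_def field_simps)
  have cos: "cos \<epsilon> < 1" using cos_monotone_0_pi[of 0 \<epsilon>] \<epsilon> by simp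
  define S where "S = 1 + (\<Sum>e\<in>UNIV. \<bar>I e\<bar>)"
  have S: "0 < S" unfolding S_def by (intro add_pos_nonneg sum_nonneg) auto
  define \<delta> where "\<delta> = arsinh (sqrt ((1 - cos \<epsilon>) / S))"
  show \<delta>: "0 < \<delta>" using cos S by (simp add: \<delta>_def)
  fix v :: "real^'v" and i assume v: "v \<in> pos_orthant" and lt: "v $ i < \<delta>"
  have vi: "0 < v $ i" using v by (simp add: pos_orthant_def)
  have "sinh (v $ i) < sqrt ((1 - cos \<epsilon>) / S)"
    using lt sinh_real_less_iff[of "v $ i" \<delta>] by (simp add: \<delta>_def)
  then have "(sinh (v $ i))\<^sup>2 \<le> (sqrt ((1 - cos \<epsilon>) / S))\<^sup>2"
    using vi by (intro power_mono) auto
  then have "(sinh (v $ i))\<^sup>2 * S \<le> 1 - cos \<epsilon>" using cos S by (simp add: field_simps)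
  then have large: "S \<le> (1 - cos \<epsilon>) * (sinh (dual v $ i))\<^sup>2"
    using vi by (simp add: dual_def sinh_dual_radius power_divide pos_le_divide_eq mult.commute)
  have "(\<Sum>f\<in>{f \<in> F. i \<in> f}. angle (dual v) f i) \<le> card {f \<in> F. i \<in> f} * \<epsilon>"
    using angle_le_of_large_radius[OF dual_in_pos_orthant[OF v] _ _ _ \<epsilon>(2)] \<epsilon>(1) large
    by (intro sum_bounded_above) (auto simp: S_def)
  also have "\<dots> \<le> card F * \<epsilon>"
    using \<epsilon> by (intro mult_right_mono) (auto intro: card_mono)
  also have "\<dots> \<le> pi" by (simp add: \<epsilon>_def field_simps)
  finally show "0 < dual_field v $ i" unfolding dual_field_component using pi_gt_zero by linarith
qed

section \<open>The extended flow\<close>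

text \<open>The factor \<open>sinh (r t $ i)\<close> of the flow cancels against the derivative of \<open>dual\<close>.\<close>

lemma dual_solution_of_ext_flow:
  assumes sol: "ext_flow_solution F I J r" and t: "t \<in> J"
  shows "dual (r t) \<in> pos_orthant" "dual (dual (r t)) = r t"
    and "((\<lambda>t. dual (r t)) has_vector_derivative dual_field (dual (r t))) (at t within J)"
proof -
  have r: "r t \<in> pos_orthant"
    and d: "(r has_vector_derivative (\<chi> i. - ext_curvature F I (r t) i * sinh (r t $ i))) (at t within J)"
    using sol t unfolding ext_flow_solution_def by auto
  show "dual (r t) \<in> pos_orthant" "dual (dual (r t)) = r t"
    using r by (simp_all add: dual_in_pos_orthant dual_dual)
  have chain: "((\<lambda>t. dual (r t)) has_derivative
      (\<lambda>s. \<chi> i. - sinh (dual (r t) $ i) * (s *\<^sub>R (\<chi> i. - ext_curvature F I (r t) i * sinh (r t $ i))) $ i)) (at t within J)"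
    using has_derivative_compose[OF d[unfolded has_vector_derivative_def] has_derivative_dual[OF r]] .
  have "- sinh (dual (r t) $ i) * (s *\<^sub>R (\<chi> i. - ext_curvature F I (r t) i * sinh (r t $ i))) $ i
      = (s *\<^sub>R dual_field (dual (r t))) $ i" for s i
  proof -
    have "0 < r t $ i" using r by (simp add: pos_orthant_def)
    then have "sinh (dual (r t) $ i) * sinh (r t $ i) = 1"
      by (simp add: dual_def sinh_dual_radius)
    then show ?thesis using r by (simp add: dual_field_def dual_dual)
  qed
  then have "(\<lambda>s. \<chi> i. - sinh (dual (r t) $ i) * (s *\<^sub>R (\<chi> i. - ext_curvature F I (r t) i * sinh (r t $ i))) $ i)
      = (\<lambda>s. s *\<^sub>R dual_field (dual (r t)))"
    by (intro ext) (simp only: vec_eq_iff vec_lambda_beta simp_thms)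
  with chain show "((\<lambda>t. dual (r t)) has_vector_derivative dual_field (dual (r t))) (at t within J)"
    unfolding has_vector_derivative_def by simp
qed

lemma ext_flow_of_dual_solution:
  assumes "\<And>t. t \<in> J \<Longrightarrow> v t \<in> pos_orthant"
    and "\<And>t. t \<in> J \<Longrightarrow> (v has_vector_derivative dual_field (v t)) (at t within J)"
  shows "ext_flow_solution F I J (\<lambda>t. dual (v t))"
  unfolding ext_flow_solution_def
proof (intro ballI conjI)
  fix t assume t: "t \<in> J"
  show "dual (v t) \<in> pos_orthant" using assms(1)[OF t] by (rule dual_in_pos_orthant)
  have "((\<lambda>t. dual (v t)) has_derivative (\<lambda>s. \<chi> i. - sinh (dual (v t) $ i) * (s *\<^sub>R dual_field (v t)) $ i)) (at t within J)"
    using has_derivative_compose[OF assms(2)[OF t, unfolded has_vector_derivative_def]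
        has_derivative_dual[OF assms(1)[OF t]]] .
  moreover have "(\<chi> i. - sinh (dual (v t) $ i) * (s *\<^sub>R dual_field (v t)) $ i)
      = s *\<^sub>R (\<chi> i. - ext_curvature F I (dual (v t)) i * sinh (dual (v t) $ i))" for s
    by (simp add: vec_eq_iff dual_field_def)
  ultimately show "((\<lambda>t. dual (v t)) has_vector_derivative
      (\<chi> i. - ext_curvature F I (dual (v t)) i * sinh (dual (v t) $ i))) (at t within J)"
    unfolding has_vector_derivative_def by simp
qed

text \<open>The set \<open>K\<close> on which all dual radii are at least \<open>\<eta>\<close> is invariant under short Euler steps: a
  component below \<open>\<delta>\<close> increases by the barrier, and one above \<open>\<delta>\<close> loses at most \<open>\<delta> - \<eta>\<close>.\<close>

lemma ext_flow_exists:
  assumes r0: "r0 \<in> pos_orthant"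
  shows "\<exists>R. R 0 = r0 \<and> ext_flow_solution F I {0..} R"
proof -
  define x where "x = dual r0"
  have x: "0 < x $ i" for i
    using dual_in_pos_orthant[OF r0] by (simp add: x_def pos_orthant_def)
  obtain \<delta> where \<delta>: "0 < \<delta>" "\<And>v i. v \<in> pos_orthant \<Longrightarrow> v $ i < \<delta> \<Longrightarrow> 0 < dual_field v $ i"
    using dual_field_barrier by blast
  define \<eta> where "\<eta> = Min (insert (\<delta> / 2) (range (\<lambda>i. x $ i)))"
  have \<eta>: "0 < \<eta>" "\<eta> < \<delta>" "\<eta> \<le> x $ i" for i
  proof -
    show "0 < \<eta>" using \<delta>(1) x by (auto simp: \<eta>_def)
    have "\<eta> \<le> \<delta> / 2" "\<eta> \<le> x $ i" unfolding \<eta>_def by (intro Min_le; simp)+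
    then show "\<eta> < \<delta>" "\<eta> \<le> x $ i" using \<delta>(1) by auto
  qed
  define K where "K = {v :: real^'v. \<forall>i. \<eta> \<le> v $ i}"
  have K: "K \<subseteq> pos_orthant" using \<eta>(1) by (auto simp: K_def pos_orthant_def intro: less_le_trans)
  define B where "B = CARD('v) * (2 * pi + card F * pi)"
  have B: "norm (dual_field v) \<le> B" if "v \<in> K" for v
    using norm_dual_field_le that K by (auto simp: B_def)
  have B0: "0 < B" using pi_gt_zero by (simp add: B_def add_pos_nonneg)
  obtain v where v: "v 0 = x" "\<And>t. 0 \<le> t \<Longrightarrow> v t \<in> K"
    "\<And>t. 0 \<le> t \<Longrightarrow> (v has_vector_derivative dual_field (v t)) (at t within {0..})"
  proof (rule dissipative_flow_exists[of K dual_field x "(\<delta> - \<eta>) / B" B])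
    have "K = (\<Inter>i. {v. \<eta> \<le> v $ i})" by (auto simp: K_def)
    also have "closed \<dots>" by (intro closed_INT ballI closed_Collect_le continuous_intros)
    finally show "closed K" .
    show "continuous_on K dual_field" using continuous_on_dual_field K by (rule continuous_on_subset)
    show "x \<in> K" using \<eta>(3) by (simp add: K_def)
    show "0 < (\<delta> - \<eta>) / B" using \<eta>(2) B0 by simp
    show "y + h *\<^sub>R dual_field y \<in> K" if y: "y \<in> K" and h: "0 \<le> h" "h \<le> (\<delta> - \<eta>) / B" for y h
      unfolding K_def
    proof (intro CollectI allI)
      fix i
      have yi: "\<eta> \<le> y $ i" using y by (simp add: K_def)
      show "\<eta> \<le> (y + h *\<^sub>R dual_field y) $ i"
      proof (cases "y $ i < \<delta>")
        case True
        have "0 < dual_field y $ i" using \<delta>(2) K y True by blast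
        then have "0 \<le> h * dual_field y $ i" using h(1) by simp
        then show ?thesis using yi by simp
      next
        case False
        have "\<bar>h * dual_field y $ i\<bar> \<le> h * B"
          using component_le_norm_cart[of "dual_field y" i] B[OF y] h(1)
          by (simp add: abs_mult mult_left_mono)
        also have "\<dots> \<le> \<delta> - \<eta>" using h(2) B0 by (simp add: pos_le_divide_eq)
        finally show ?thesis using False by simp
      qed
    qed
    show "norm (dual_field y) \<le> B" if "y \<in> K" for y using B[OF that] .
    show "(y - z) \<bullet> (dual_field y - dual_field z) \<le> 0" if "y \<in> K" "z \<in> K" for y z
      using dual_field_dissipative that K by blast
  qed blast
  have "ext_flow_solution F I {0..} (\<lambda>t. dual (v t))"
    using v(2,3) K by (intro ext_flow_of_dual_solution) auto
  moreover have "dual (v 0) = r0" using r0 by (simp add: v(1) x_def dual_dual)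
  ultimately show ?thesis by (intro exI[of _ "\<lambda>t. dual (v t)"]) simp
qed

lemma ext_flow_unique:
  assumes r: "ext_flow_solution F I {0..<T} r" and s: "ext_flow_solution F I {0..<T} s"
    and "r 0 = s 0" and t: "t \<in> {0..<T}"
  shows "r t = s t"
proof -
  have sub: "{0..t} \<subseteq> {0..<T}" using t by auto
  have "norm (dual (r t) - dual (s t)) \<le> norm (dual (r 0) - dual (s 0)) * exp (- 0 * t)"
  proof (rule norm_decay)
    show "0 \<le> t" using t by simp
    fix u assume "u \<in> {0..t}"
    then have u: "u \<in> {0..<T}" using sub by blast
    show "((\<lambda>t. dual (r t) - dual (s t)) has_vector_derivative
        dual_field (dual (r u)) - dual_field (dual (s u))) (at u within {0..t})"
      using dual_solution_of_ext_flow(3)[OF r u] dual_solution_of_ext_flow(3)[OF s u]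
      by (intro has_vector_derivative_diff has_vector_derivative_within_subset[OF _ sub])
  next
    fix u assume "0 < u" "u < t"
    then have u: "u \<in> {0..<T}" using t by simp
    show "(dual (r u) - dual (s u)) \<bullet> (dual_field (dual (r u)) - dual_field (dual (s u)))
        \<le> - 0 * (norm (dual (r u) - dual (s u)))\<^sup>2"
      using dual_field_dissipative[OF dual_solution_of_ext_flow(1)[OF r u] dual_solution_of_ext_flow(1)[OF s u]]
      by simp
  qed
  then have "dual (r t) = dual (s t)" using \<open>r 0 = s 0\<close> by simp
  then show ?thesis
    using dual_solution_of_ext_flow(2)[OF r t] dual_solution_of_ext_flow(2)[OF s t] by metis
qed

lemma ext_curvature_eq_curvature:
  assumes "r \<in> Omega F I"
  shows "ext_curvature F I r i = curvature F I r i"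
proof -
  have "face_angle gen_angle I r i f = face_angle inner_angle I r i f" if f: "f \<in> F" "i \<in> f" for f
  proof -
    obtain j k where jk: "f = {i, j, k}" "i \<noteq> j" "j \<noteq> k" "i \<noteq> k" using face_cases_at[OF f] by metis
    have c: "card {i, j, k} = 3" using jk by simp
    have "strict_triangle (edge_length I r i j) (edge_length I r j k) (edge_length I r i k)"
      using assms f(1) jk(1) unfolding Omega_def by blast
    then have "strict_triangle (edge_length I r j k) (edge_length I r i k) (edge_length I r i j)"
      by (auto simp: strict_triangle_def)
    then show ?thesis
      unfolding jk(1) face_angle_gen_angle[OF c] face_angle_inner_angle[OF assms f(1)[unfolded jk(1)] c]
      by (simp only: gen_angle_def if_True)
  qed
  then show ?thesis unfolding ext_curvature_def curvature_def by simp
qed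

lemma flow_solution_imp_ext_flow_solution:
  assumes "flow_solution F I J r"
  shows "ext_flow_solution F I J r"
  using assms unfolding flow_solution_def ext_flow_solution_def
  by (auto simp: ext_curvature_eq_curvature) (simp add: Omega_def)

lemma ext_flow_converges_exponentially:
  assumes sol: "ext_flow_solution F I {0..} R" and zero: "zero_curvature_metric F I rs"
  shows "converges_exponentially R rs"
proof -
  have O: "rs \<in> Omega F I" and rs: "rs \<in> pos_orthant"
    using zero by (auto simp: zero_curvature_metric_def Omega_def)
  define w where "w = dual rs"
  define v where "v = (\<lambda>t. dual (R t))"
  have w: "w \<in> pos_orthant" "dual w = rs" using rs by (simp_all add: w_def dual_in_pos_orthant dual_dual)
  have w0: "dual_field w = 0"
    using zero O by (simp add: dual_field_def w(2) vec_eq_iff ext_curvature_eq_curvature zero_curvature_metric_def)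
  have v: "v t \<in> pos_orthant" "dual (v t) = R t"
    "(v has_vector_derivative dual_field (v t)) (at t within {0..})" if "0 \<le> t" for t
    using dual_solution_of_ext_flow[OF sol, of t] that by (simp_all add: v_def)
  have der: "((\<lambda>t. v t - w) has_vector_derivative dual_field (v s)) (at s within {0..t})"
    if "s \<in> {0..t}" for s t
  proof -
    have "((\<lambda>t. v t - w) has_vector_derivative dual_field (v s) - 0) (at s within {0..t})"
      using that by (intro has_vector_derivative_diff has_vector_derivative_const
          has_vector_derivative_within_subset[OF v(3)]) auto
    then show ?thesis by simp
  qed
  \<comment> \<open>Coercivity holds on bounded sets only, so the solution is first confined to a ball.\<close>
  have bound: "norm (v t - w) \<le> norm (v 0 - w)" if "0 \<le> t" for t
  proof -
    have "norm (v t - w) \<le> norm (v 0 - w) * exp (- 0 * t)"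
    proof (rule norm_decay[OF that der])
      fix s assume "0 < s" "s < t"
      then show "(v s - w) \<bullet> dual_field (v s) \<le> - 0 * (norm (v s - w))\<^sup>2"
        using dual_field_dissipative[OF v(1)[of s] w(1)] by (simp add: w0)
    qed
    then show ?thesis by simp
  qed
  obtain c where c: "0 < c" and coer: "\<And>y. y \<in> pos_orthant \<Longrightarrow> norm (y - w) \<le> norm (v 0 - w) \<Longrightarrow>
      (y - w) \<bullet> dual_field y \<le> - c * (norm (y - w))\<^sup>2"
    using dual_field_coercive[OF w(1) _ w0, of "norm (v 0 - w)"] O w(2) by auto
  have decay: "norm (v t - w) \<le> norm (v 0 - w) * exp (- c * t)" if "0 \<le> t" for t
    by (rule norm_decay[OF that der]) (use coer v(1) bound in auto)
  \<comment> \<open>Back to the radii: \<open>dual\<close> is Lipschitz at \<open>w\<close>, which serves for large times; for the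
    remaining compact range of times any bound is exponential.\<close>
  obtain d M where d: "0 < d" and M: "0 \<le> M" and lip: "\<And>y. norm (y - w) < d \<Longrightarrow> norm (dual y - rs) \<le> M * norm (y - w)"
  proof -
    have D: "(dual has_derivative (\<lambda>h. \<chi> i. - sinh (dual w $ i) * h $ i)) (at w)" (is "(dual has_derivative ?D) _")
      by (rule has_derivative_dual[OF w(1)])
    obtain d where d: "d > 0" "\<And>y. norm (y - w) < d \<Longrightarrow> norm (dual y - dual w - ?D (y - w)) \<le> 1 * norm (y - w)"
      using D unfolding has_derivative_at_alt by (metis zero_less_one)
    obtain M where M: "M \<ge> 0" "\<And>h. norm (?D h) \<le> norm h * M"
      using bounded_linear.nonneg_bounded[OF has_derivative_bounded_linear[OF D]] by blast
    have "norm (dual y - rs) \<le> (1 + M) * norm (y - w)" if "norm (y - w) < d" for y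
      using norm_triangle_mono[OF d(2)[OF that] M(2)[of "y - w"]] by (simp add: w(2) algebra_simps)
    with d(1) M(1) show ?thesis by (intro that[of d "1 + M"]) auto
  qed
  have "((\<lambda>t. norm (v 0 - w) * exp (- c * t)) \<longlongrightarrow> 0) at_top"
    using c by (rule tendsto_exp_decay)
  then have "\<forall>\<^sub>F t in at_top. norm (v 0 - w) * exp (- c * t) < d"
    using d by (rule order_tendstoD(2))
  then obtain T where T: "\<And>t. T \<le> t \<Longrightarrow> norm (v 0 - w) * exp (- c * t) < d"
    unfolding eventually_at_top_linorder by blast
  define T' where "T' = max T 0"
  have "continuous_on {0..} R"
  proof (rule continuous_on_vector_derivative)
    show "(R has_vector_derivative (\<chi> i. - ext_curvature F I (R t) i * sinh (R t $ i))) (at t within {0..})"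
      if "t \<in> {0..}" for t using sol that unfolding ext_flow_solution_def by blast
  qed
  then have "continuous_on {0..T'} R" by (rule continuous_on_subset) auto
  then have "continuous_on {0..T'} (\<lambda>t. R t - rs)" by (intro continuous_intros)
  then have "bounded ((\<lambda>t. R t - rs) ` {0..T'})"
    by (intro compact_imp_bounded compact_continuous_image) auto
  then obtain N where N: "0 < N" "\<And>t. t \<in> {0..T'} \<Longrightarrow> norm (R t - rs) \<le> N"
    unfolding bounded_pos by auto
  define C where "C = M * norm (v 0 - w) + N * exp (c * T')"
  have "norm (R t - rs) \<le> C * exp (- c * t)" if t: "0 \<le> t" for t
  proof (cases "t \<le> T'")
    case True
    have "norm (R t - rs) \<le> N * 1" using N(2)[of t] True t by simp
    also have "\<dots> \<le> N * (exp (c * T') * exp (- c * t))"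
      using N(1) True c by (intro mult_left_mono) (auto simp: exp_add[symmetric])
    also have "\<dots> \<le> C * exp (- c * t)"
      using M by (simp add: C_def distrib_right)
    finally show ?thesis .
  next
    case False
    then have "T \<le> t" by (simp add: T'_def)
    then have "norm (v t - w) < d" using decay[OF t] T[of t] by linarith
    then have "norm (R t - rs) \<le> M * norm (v t - w)" using lip v(2)[OF t] by metis
    also have "\<dots> \<le> M * (norm (v 0 - w) * exp (- c * t))" by (rule mult_left_mono[OF decay[OF t] M])
    also have "\<dots> \<le> C * exp (- c * t)"
      using N(1) by (simp add: C_def distrib_right mult.assoc)
    finally show ?thesis .
  qed
  moreover have "0 < C" using M N(1) by (simp add: C_def add_nonneg_pos)
  ultimately show ?thesis unfolding converges_exponentially_def using c by blast
qed

lemma convergent_ext_solution_imp_zero_curvature: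
  assumes "ext_flow_solution F I {0..} R" and p: "p \<in> Omega F I" and lim: "(R \<longlongrightarrow> p) at_top"
  shows "zero_curvature_metric F I p"
proof -
  have pp: "p \<in> pos_orthant" using p by (simp add: Omega_def)
  have "curvature F I p i = 0" for i
  proof -
    have "- ext_curvature F I p i * sinh (p $ i) = 0"
    proof (rule derivative_limit_eq_0)
      fix t :: real assume "0 \<le> t"
      then have "(R has_derivative (\<lambda>s. s *\<^sub>R (\<chi> i. - ext_curvature F I (R t) i * sinh (R t $ i)))) (at t within {0..})"
        using assms(1) by (auto simp: ext_flow_solution_def has_vector_derivative_def)
      from bounded_linear.has_derivative[OF bounded_linear_vec_nth this, of i]
      show "((\<lambda>t. R t $ i) has_real_derivative - ext_curvature F I (R t) i * sinh (R t $ i)) (at t within {0..})"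
        by (rule has_derivative_imp_has_field_derivative) simp
    next
      show "((\<lambda>t. R t $ i) \<longlongrightarrow> p $ i) at_top" by (intro tendsto_intros lim)
      have "isCont (\<lambda>r. ext_curvature F I r i) p"
        using continuous_on_ext_curvature[of i] pp by (simp add: continuous_on_eq_continuous_at[OF open_pos_orthant])
      then have "((\<lambda>t. ext_curvature F I (R t) i) \<longlongrightarrow> ext_curvature F I p i) at_top"
        using lim by (rule isCont_tendsto_compose)
      then show "((\<lambda>t. - ext_curvature F I (R t) i * sinh (R t $ i)) \<longlongrightarrow> - ext_curvature F I p i * sinh (p $ i)) at_top"
        by (intro tendsto_intros lim)
    qed
    moreover have "sinh (p $ i) \<noteq> 0" using pp by (auto simp: pos_orthant_def less_imp_neq[symmetric])
    ultimately show ?thesis using ext_curvature_eq_curvature[OF p] by simp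
  qed
  with p show ?thesis by (simp add: zero_curvature_metric_def)
qed

text \<open>For a constant radius \<open>a\<close> each edge satisfies \<open>(cosh a)\<^sup>2 \<le> cosh l < (cosh a)\<^sup>2 * (cosh a)\<^sup>2\<close> once
  \<open>a\<close> is large, and \<open>cosh (l' + l'') \<ge> cosh l' * cosh l''\<close> gives the triangle inequalities.\<close>

lemma Omega_nonempty: "Omega F I \<noteq> {}"
proof -
  define S where "S = (\<Sum>e\<in>UNIV. \<bar>I e\<bar>)"
  have S: "0 \<le> S" by (simp add: S_def sum_nonneg)
  have IS: "I e \<le> S" for e
    unfolding S_def using member_le_sum[of e UNIV "\<lambda>e. \<bar>I e\<bar>"] by simp
  define a where "a = arcosh (2 + S)"
  have a: "0 < a" "cosh a = 2 + S" using S by (simp_all add: a_def)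
  define r :: "real^'v" where "r = (\<chi> i. a)"
  have r: "r \<in> pos_orthant" using a by (simp add: r_def pos_orthant_def)
  have lower: "(cosh a)\<^sup>2 \<le> edge_cosh I r i j" and upper: "edge_cosh I r i j < (cosh a)\<^sup>2 * (cosh a)\<^sup>2"
    if "0 \<le> I {i, j}" for i j
  proof -
    have e: "edge_cosh I r i j = (cosh a)\<^sup>2 + I {i, j} * (sinh a)\<^sup>2"
      by (simp add: edge_cosh_def r_def power2_eq_square)
    show "(cosh a)\<^sup>2 \<le> edge_cosh I r i j" using that by (simp add: e)
    have "I {i, j} * (sinh a)\<^sup>2 \<le> S * (cosh a)\<^sup>2"
      using IS S by (intro mult_mono) (auto simp: cosh_square_eq)
    then have "edge_cosh I r i j \<le> (1 + S) * (cosh a)\<^sup>2" by (simp add: e algebra_simps)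
    also have "\<dots> < (cosh a)\<^sup>2 * (cosh a)\<^sup>2"
    proof (rule mult_strict_right_mono)
      have "(1 + S) * 1 < (2 + S) * (2 + S)" using S by (intro mult_strict_mono) auto
      then show "1 + S < (cosh a)\<^sup>2" by (simp add: a(2) power2_eq_square)
    qed simp
    finally show "edge_cosh I r i j < (cosh a)\<^sup>2 * (cosh a)\<^sup>2" .
  qed
  have tri: "edge_length I r i j < edge_length I r k l + edge_length I r m n"
    if I: "0 \<le> I {i, j}" "0 \<le> I {k, l}" "0 \<le> I {m, n}" for i j k l m n
  proof -
    note pos = edge_length_pos[of r I, OF r]
    have "cosh (edge_length I r i j) < (cosh a)\<^sup>2 * (cosh a)\<^sup>2"
      using upper[OF I(1)] r I by (simp add: cosh_edge_length)
    also have "\<dots> \<le> edge_cosh I r k l * edge_cosh I r m n"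
      using lower[OF I(2)] lower[OF I(3)] edge_cosh_gt_1[of r I k l] r I by (intro mult_mono) auto
    also have "\<dots> \<le> cosh (edge_length I r k l + edge_length I r m n)"
      using pos[OF I(2)] pos[OF I(3)] r I by (simp add: cosh_add cosh_edge_length)
    finally show ?thesis
      using pos[OF I(1)] pos[OF I(2)] pos[OF I(3)]
        cosh_real_nonneg_less_iff[of "edge_length I r i j" "edge_length I r k l + edge_length I r m n"] by simp
  qed
  have "r \<in> Omega F I"
    unfolding Omega_def
  proof (intro CollectI conjI allI impI r)
    fix i j k assume f: "{i, j, k} \<in> F"
    have "i \<noteq> j" "j \<noteq> k" "i \<noteq> k" using card_face[OF f] by (auto simp: card_insert_if split: if_splits)
    then have "0 \<le> I {i, j}" "0 \<le> I {j, k}" "0 \<le> I {i, k}" using I_nonneg[OF f] by auto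
    then show "strict_triangle (edge_length I r i j) (edge_length I r j k) (edge_length I r i k)"
      unfolding strict_triangle_def using tri by blast
  qed
  then show ?thesis by blast
qed

end

theorem theorem1p12:
  fixes M :: "'m topology"
    and E F :: "'v::finite set set"
    and I :: "'v set \<Rightarrow> real"
  assumes "closed_surface M"
    and "triangulates M E F"
    and "\<forall>e\<in>E. 0 \<le> I e"
  shows "((\<exists>rs. zero_curvature_metric F I rs) \<longleftrightarrow>
          (\<forall>r0\<in>Omega F I. \<exists>R. extends_flow_from F I r0 R \<and> convergent_ext_solution F I R)) \<and>
         (\<forall>R. R 0 \<in> Omega F I \<and> convergent_ext_solution F I R \<longrightarrow>
            (\<exists>rs. zero_curvature_metric F I rs) \<and>
            (\<forall>rs. zero_curvature_metric F I rs \<longrightarrow> converges_exponentially R rs))"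
proof -
  have complex: "simplicial_2_complex E F" using assms(2) by (simp add: triangulates_def)
  interpret inversive_complex F I
  proof
    show "card f = 3" if "f \<in> F" for f using complex that by (simp add: simplicial_2_complex_def)
    show "0 \<le> I {i, j}" if "f \<in> F" "i \<in> f" "j \<in> f" "i \<noteq> j" for f i j
    proof -
      have "{i, j} \<subseteq> f" "card {i, j} = 2" using that by auto
      then have "{i, j} \<in> E" using complex that(1) unfolding simplicial_2_complex_def by blast
      then show ?thesis using assms(3) by blast
    qed
  qed
  have zero: "\<exists>rs. zero_curvature_metric F I rs" if "convergent_ext_solution F I R" for R
    using that convergent_ext_solution_imp_zero_curvature unfolding convergent_ext_solution_def by blast
  have forward: "\<exists>R. extends_flow_from F I r0 R \<and> convergent_ext_solution F I R"
    if rs: "zero_curvature_metric F I rs" and r0: "r0 \<in> Omega F I" for rs r0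
  proof -
    have "r0 \<in> pos_orthant" using r0 by (simp add: Omega_def)
    then obtain R where R: "R 0 = r0" "ext_flow_solution F I {0..} R" using ext_flow_exists by blast
    have "(R \<longlongrightarrow> rs) at_top"
      using ext_flow_converges_exponentially[OF R(2) rs] by (rule converges_exponentially_imp_tendsto)
    moreover have "rs \<in> Omega F I" using rs by (simp add: zero_curvature_metric_def)
    ultimately have "convergent_ext_solution F I R" using R(2) by (auto simp: convergent_ext_solution_def)
    moreover have "R t = r t" if "flow_solution F I {0..<T} r" "r 0 = r0" "t \<in> {0..<T}" for T r t
    proof (rule ext_flow_unique[OF _ flow_solution_imp_ext_flow_solution[OF that(1)] _ that(3)])
      show "ext_flow_solution F I {0..<T} R"
        using R(2) unfolding ext_flow_solution_def
        by (intro ballI conjI; elim ballE conjE)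
          (auto elim: has_vector_derivative_within_subset)
      show "R 0 = r 0" using R(1) that(2) by simp
    qed
    then have "extends_flow_from F I r0 R" using R(1) unfolding extends_flow_from_def by blast
    ultimately show ?thesis by blast
  qed
  obtain r0 where "r0 \<in> Omega F I" using Omega_nonempty by blast
  then have "\<exists>rs. zero_curvature_metric F I rs"
    if "\<forall>r0\<in>Omega F I. \<exists>R. extends_flow_from F I r0 R \<and> convergent_ext_solution F I R"
    using that zero by blast
  moreover have "converges_exponentially R rs"
    if "convergent_ext_solution F I R" "zero_curvature_metric F I rs" for R rs
    using that ext_flow_converges_exponentially unfolding convergent_ext_solution_def by blast
  ultimately show ?thesis using forward zero by blast
qed

end
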